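(* Let $L\in\mathbb{Z}_{>0}$, $\gamma,h,\mu_1,\dots,\mu_L\in\mathbb{C}$, and let $\mathcal{Z}(\lambda_1,\dots,\lambda_L)=\langle\bar 0|\,\mathcal{B}(\lambda_1)\mathcal{B}(\lambda_2)\cdots\mathcal{B}(\lambda_L)\,|0\rangle$ be the partition function of the six-vertex model with one reflecting end and domain-wall boundaries (see context). Then for all $\lambda_0,\lambda_1,\dots,\lambda_L\in\mathbb{C}$ (at which the coefficients below are defined) \[ M_0\,\mathcal{Z}(\lambda_1,\dots,\lambda_L)+\sum_{i=1}^{L} M_i\,\mathcal{Z}(\lambda_0,\lambda_1,\dots,\lambda_{i-1},\lambda_{i+1},\dots,\lambda_L)=0, \] where \[ M_0=\bar\Lambda_{\mathcal{A}}(\lambda_0)-\Lambda_{\mathcal{A}}(\lambda_0)\prod_{j=1}^{L}\frac{a(\lambda_j-\lambda_0)}{b(\lambda_j-\lambda_0)}\frac{b(\lambda_j+\lambda_0)}{a(\lambda_j+\lambda_0)}, \] \[ M_i=\frac{b(2\lambda_i)}{a(2\lambda_i)}\frac{c(\lambda_i-\lambda_0)}{b(\lambda_i-\lambda_0)}\Lambda_{\mathcal{A}}(\lambda_i)\prod_{\substack{j=1\\ j\neq i}}^{L}\frac{a(\lambda_j-\lambda_i)}{b(\lambda_j-\lambda_i)}\frac{b(\lambda_j+\lambda_i)}{a(\lambda_j+\lambda_i)} +\frac{c(\lambda_i+\lambda_0)}{a(\lambda_i+\lambda_0)}\Lambda_{\tilde{\mathcal{D}}}(\lambda_i)\prod_{\substack{j=1\\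 j\neq i}}^{L}\frac{a(\lambda_i-\lambda_j)}{b(\lambda_i-\lambda_j)}\frac{a(\lambda_i+\lambda_j+\gamma)}{b(\lambda_i+\lambda_j+\gamma)}, \] and \[ \Lambda_{\mathcal{A}}(\lambda)=b(h+\lambda)\prod_{j=1}^{L}a(\lambda-\mu_j)a(\lambda+\mu_j),\qquad \Lambda_{\tilde{\mathcal{D}}}(\lambda)=-\frac{b(2\lambda)}{a(2\lambda)}a(\lambda-h)\prod_{j=1}^{L}b(\lambda-\mu_j)b(\lambda+\mu_j), \] \[ \bar\Lambda_{\mathcal{A}}(\lambda)=\frac{c(2\lambda)}{a(2\lambda)}b(h-\lambda)\prod_{j=1}^{L}a(\lambda-\mu_j)a(\lambda+\mu_j)+\frac{b(2\lambda)}{a(2\lambda)}a(\lambda+h)\prod_{j=1}^{L}b(\lambda-\mu_j)b(\lambda+\mu_j). \]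
   Context: Set $a(\lambda)=\sinh(\lambda+\gamma)$, $b(\lambda)=\sinh(\lambda)$, $c(\lambda)=\sinh(\gamma)$ (a constant function). The $R$-matrix $\mathcal{R}(\lambda)\in\mathrm{End}(\mathbb{C}^2\otimes\mathbb{C}^2)$ is, in the basis $e_1\otimes e_1,e_1\otimes e_2,e_2\otimes e_1,e_2\otimes e_2$, the matrix with rows $(a,0,0,0)$, $(0,b,c,0)$, $(0,c,b,0)$, $(0,0,0,a)$, all evaluated at $\lambda$. Let $\mathbb{V}_0\cong\mathbb{C}^2$ (auxiliary space) and $\mathbb{V}_{\mathcal{Q}}=(\mathbb{C}^2)^{\otimes L}$ with factors labelled $1,\dots,L$; $\mathcal{R}_{0j}$ denotes $\mathcal{R}$ acting on $\mathbb{V}_0$ and the $j$-th factor. Define $\tau(\lambda)=\mathcal{R}_{0L}(\lambda-\mu_L)\cdots\mathcal{R}_{02}(\lambda-\mu_2)\mathcal{R}_{01}(\lambda-\mu_1)$ and $\bar\tau(\lambda)=\mathcal{R}_{01}(\lambda+\mu_1)\mathcal{R}_{02}(\lambda+\mu_2)\cdots\mathcal{R}_{0L}(\lambda+\mu_L)$, and $\mathcal{K}(\lambda)=\mathrm{diag}(\sinh(h+\lambda),\sinh(h-\lambda))$ acting on $\mathbb{V}_0$. The double-row monodromy matrix is $\mathcal{T}(\lambda)=\tau(\lambda)\mathcal{K}(\lambda)\bar\tau(\lambda)$, written as a $2\times 2$ matrix in $\mathbb{V}_0$ as $\begin{pmatrix}\mathcal{A}(\lambda)&\mathcal{B}(\lambda)\\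 \mathcal{C}(\lambda)&\mathcal{D}(\lambda)\end{pmatrix}$ with entries in $\mathrm{End}(\mathbb{V}_{\mathcal{Q}})$. Let $|0\rangle=e_1^{\otimes L}$ and $\langle\bar0|$ the dual (transpose) of $e_2^{\otimes L}$, where $e_1=(1,0)^T$, $e_2=(0,1)^T$. The partition function is $\mathcal{Z}(\lambda_1,\dots,\lambda_L)=\langle\bar 0|\mathcal{B}(\lambda_1)\cdots\mathcal{B}(\lambda_L)|0\rangle$ (a function also of $\mu_j,\gamma,h$). *)

theory Defs
  imports Complex_Main
begin

definition wa :: "complex \<Rightarrow> complex \<Rightarrow> complex" where
  "wa \<gamma> u = sinh (u + \<gamma>)"

definition wb :: "complex \<Rightarrow> complex" where
  "wb u = sinh u"

definition wc :: "complex \<Rightarrow> complex \<Rightarrow> complex" where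
  "wc \<gamma> u = sinh \<gamma>"

text \<open>Basis vector e_1 is encoded as index 0, e_2 as index 1.
 A basis vector of (C^2)^{\<otimes> L} is a list xs of length L with entries in {0,1};
 the j-th tensor factor (j = 1..L) corresponds to list position j - 1.
 Operators are given by their matrix entries (kernels).\<close>

definition basis :: "nat \<Rightarrow> nat list set" where
  "basis L = {xs. length xs = L \<and> set xs \<subseteq> {0, 1}}"

type_synonym qop = "nat list \<Rightarrow> nat list \<Rightarrow> complex"
type_synonym kern = "(nat \<times> nat list) \<Rightarrow> (nat \<times> nat list) \<Rightarrow> complex"

definition kmul :: "nat \<Rightarrow> kern \<Rightarrow> kern \<Rightarrow> kern" where
  "kmul L P Q x y = (\<Sum>z \<in> {0, 1::nat} \<times> basis L. P x z * Q z y)"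

definition kid :: kern where
  "kid x y = (if x = y then 1 else 0)"

definition qmul :: "nat \<Rightarrow> qop \<Rightarrow> qop \<Rightarrow> qop" where
  "qmul L P Q xs ys = (\<Sum>zs \<in> basis L. P xs zs * Q zs ys)"

definition qid :: qop where
  "qid xs ys = (if xs = ys then 1 else 0)"

text \<open>The R-matrix: entry at row (i,k) (= e_i \<otimes> e_k), column (i',k').\<close>
definition Rmat :: "complex \<Rightarrow> complex \<Rightarrow> nat \<times> nat \<Rightarrow> nat \<times> nat \<Rightarrow> complex" where
  "Rmat \<gamma> u r s =
     (if r = s then (if fst r = snd r then wa \<gamma> u else wb u)
      else if fst r \<noteq> snd r \<and> s = (snd r, fst r) then wc \<gamma> u
      else 0)"

definition Rop :: "nat \<Rightarrow> complex \<Rightarrow> nat \<Rightarrow> complex \<Rightarrow> kern" where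
  "Rop L \<gamma> j u x y =
     (if (\<forall>k<L. k \<noteq> j - 1 \<longrightarrow> snd x ! k = snd y ! k)
      then Rmat \<gamma> u (fst x, snd x ! (j - 1)) (fst y, snd y ! (j - 1)) else 0)"

fun tau_n :: "nat \<Rightarrow> complex \<Rightarrow> (nat \<Rightarrow> complex) \<Rightarrow> nat \<Rightarrow> complex \<Rightarrow> kern" where
  "tau_n L \<gamma> \<mu> 0 u = kid"
| "tau_n L \<gamma> \<mu> (Suc n) u = kmul L (Rop L \<gamma> (Suc n) (u - \<mu> (Suc n))) (tau_n L \<gamma> \<mu> n u)"

fun taubar_n :: "nat \<Rightarrow> complex \<Rightarrow> (nat \<Rightarrow> complex) \<Rightarrow> nat \<Rightarrow> complex \<Rightarrow> kern" where
  "taubar_n L \<gamma> \<mu> 0 u = kid"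
| "taubar_n L \<gamma> \<mu> (Suc n) u = kmul L (taubar_n L \<gamma> \<mu> n u) (Rop L \<gamma> (Suc n) (u + \<mu> (Suc n)))"

definition tau :: "nat \<Rightarrow> complex \<Rightarrow> (nat \<Rightarrow> complex) \<Rightarrow> complex \<Rightarrow> kern" where
  "tau L \<gamma> \<mu> u = tau_n L \<gamma> \<mu> L u"

definition taubar :: "nat \<Rightarrow> complex \<Rightarrow> (nat \<Rightarrow> complex) \<Rightarrow> complex \<Rightarrow> kern" where
  "taubar L \<gamma> \<mu> u = taubar_n L \<gamma> \<mu> L u"

definition Kop :: "complex \<Rightarrow> complex \<Rightarrow> kern" where
  "Kop h u x y = (if x = y then (if fst x = 0 then sinh (h + u) else sinh (h - u)) else 0)"

definition Tmon :: "nat \<Rightarrow> complex \<Rightarrow> complex \<Rightarrow> (nat \<Rightarrow> complex) \<Rightarrow> complex \<Rightarrow> kern" where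
  "Tmon L \<gamma> h \<mu> u = kmul L (kmul L (tau L \<gamma> \<mu> u) (Kop h u)) (taubar L \<gamma> \<mu> u)"

definition Bop :: "nat \<Rightarrow> complex \<Rightarrow> complex \<Rightarrow> (nat \<Rightarrow> complex) \<Rightarrow> complex \<Rightarrow> qop" where
  "Bop L \<gamma> h \<mu> u xs ys = Tmon L \<gamma> h \<mu> u (0, xs) (1, ys)"

fun Bprod :: "nat \<Rightarrow> complex \<Rightarrow> complex \<Rightarrow> (nat \<Rightarrow> complex) \<Rightarrow> complex list \<Rightarrow> qop" where
  "Bprod L \<gamma> h \<mu> [] = qid"
| "Bprod L \<gamma> h \<mu> (l # ls) = qmul L (Bop L \<gamma> h \<mu> l) (Bprod L \<gamma> h \<mu> ls)"

text \<open>Z(u_1,...,u_n) = <0bar| B(u_1) ... B(u_n) |0>, with |0> = e_1^{\<otimes> L},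
  <0bar| = (e_2^{\<otimes> L})^T.\<close>
definition Zpf :: "nat \<Rightarrow> complex \<Rightarrow> complex \<Rightarrow> (nat \<Rightarrow> complex) \<Rightarrow> complex list \<Rightarrow> complex" where
  "Zpf L \<gamma> h \<mu> ls = Bprod L \<gamma> h \<mu> ls (replicate L 1) (replicate L 0)"

definition LamA :: "nat \<Rightarrow> complex \<Rightarrow> complex \<Rightarrow> (nat \<Rightarrow> complex) \<Rightarrow> complex \<Rightarrow> complex" where
  "LamA L \<gamma> h \<mu> u = wb (h + u) * (\<Prod>j=1..L. wa \<gamma> (u - \<mu> j) * wa \<gamma> (u + \<mu> j))"

definition LamDt :: "nat \<Rightarrow> complex \<Rightarrow> complex \<Rightarrow> (nat \<Rightarrow> complex) \<Rightarrow> complex \<Rightarrow> complex" where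
  "LamDt L \<gamma> h \<mu> u = - (wb (2 * u) / wa \<gamma> (2 * u)) * wa \<gamma> (u - h)
      * (\<Prod>j=1..L. wb (u - \<mu> j) * wb (u + \<mu> j))"

definition LamAbar :: "nat \<Rightarrow> complex \<Rightarrow> complex \<Rightarrow> (nat \<Rightarrow> complex) \<Rightarrow> complex \<Rightarrow> complex" where
  "LamAbar L \<gamma> h \<mu> u =
     (wc \<gamma> (2 * u) / wa \<gamma> (2 * u)) * wb (h - u) * (\<Prod>j=1..L. wa \<gamma> (u - \<mu> j) * wa \<gamma> (u + \<mu> j))
   + (wb (2 * u) / wa \<gamma> (2 * u)) * wa \<gamma> (u + h) * (\<Prod>j=1..L. wb (u - \<mu> j) * wb (u + \<mu> j))"

end

theory Submission
  imports Defs
begin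

text \<open>
  The identity comes from evaluating \<open>\<langle>0bar| A(\<lambda>\<^sub>0) B(\<lambda>\<^sub>1) \<dots> B(\<lambda>\<^sub>L) |0\<rangle>\<close> in two ways.
  The dual vector \<open>\<langle>0bar|\<close> is a left eigenvector of \<open>A(\<lambda>\<^sub>0)\<close>. On the other hand, moving
  \<open>A(\<lambda>\<^sub>0)\<close> to the right with the exchange relations of the reflection algebra gives the usual
  off-shell Bethe ansatz expansion on the eigenvector \<open>|0\<rangle>\<close> of \<open>A\<close> and of
  \<open>D\<^sup>~(u) = D(u) - (c(2u) / a(2u)) A(u)\<close>.

  The reflection equation is proved by Sklyanin dressing
  \<open>T\<^sub>n(u) = R\<^sub>0\<^sub>n(u - \<mu>\<^sub>n) T\<^sub>n\<^sub>-\<^sub>1(u) R\<^sub>0\<^sub>n(u + \<mu>\<^sub>n)\<close>, which also yields recursions for the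
  eigenvalues. Some exchange relations follow from it only up to factors such as
  \<open>b(u + v)\<close>, which may vanish; these are removed by continuity in \<open>u\<close>.
\<close>

section \<open>The reflection equation\<close>

text \<open>
  Operators act on functions \<open>\<psi> :: (nat \<Rightarrow> bool) \<Rightarrow> complex\<close> of a spin configuration, where \<open>True\<close>
  stands for \<open>e\<^sub>2\<close>. An auxiliary space is an extra curried argument of type \<open>bool\<close>, so that operators
  compose as functions, on a lattice whose size need not be fixed.
\<close>

definition Rsite :: "complex \<Rightarrow> complex \<Rightarrow> nat \<Rightarrow> (bool \<Rightarrow> (nat \<Rightarrow> bool) \<Rightarrow> complex) \<Rightarrow> bool \<Rightarrow> (nat \<Rightarrow> bool) \<Rightarrow> complex" where
  "Rsite \<gamma> u m \<Psi> a s =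
     (if a = s m then sinh (u + \<gamma>) * \<Psi> a s else sinh u * \<Psi> a s + sinh \<gamma> * \<Psi> (s m) (s(m := a)))"

definition Raux :: "complex \<Rightarrow> complex \<Rightarrow> (bool \<Rightarrow> bool \<Rightarrow> 'q \<Rightarrow> complex) \<Rightarrow> bool \<Rightarrow> bool \<Rightarrow> 'q \<Rightarrow> complex" where
  "Raux \<gamma> u \<Phi> a b s =
     (if a = b then sinh (u + \<gamma>) * \<Phi> a b s else sinh u * \<Phi> a b s + sinh \<gamma> * \<Phi> b a s)"

definition Kaux :: "complex \<Rightarrow> complex \<Rightarrow> (bool \<Rightarrow> 'q \<Rightarrow> complex) \<Rightarrow> bool \<Rightarrow> 'q \<Rightarrow> complex" where
  "Kaux h u \<Psi> a s = (if a then sinh (h - u) else sinh (h + u)) * \<Psi> a s"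

definition on1 :: "((bool \<Rightarrow> 'q) \<Rightarrow> bool \<Rightarrow> 'q) \<Rightarrow> (bool \<Rightarrow> bool \<Rightarrow> 'q) \<Rightarrow> bool \<Rightarrow> bool \<Rightarrow> 'q" where
  "on1 F \<Phi> a b = F (\<lambda>a'. \<Phi> a' b) a"

definition on2 :: "((bool \<Rightarrow> 'q) \<Rightarrow> bool \<Rightarrow> 'q) \<Rightarrow> (bool \<Rightarrow> bool \<Rightarrow> 'q) \<Rightarrow> bool \<Rightarrow> bool \<Rightarrow> 'q" where
  "on2 F \<Phi> a = F (\<Phi> a)"

fun dressed :: "complex \<Rightarrow> complex \<Rightarrow> (nat \<Rightarrow> complex) \<Rightarrow> nat \<Rightarrow> complex \<Rightarrow> (bool \<Rightarrow> (nat \<Rightarrow> bool) \<Rightarrow> complex) \<Rightarrow> bool \<Rightarrow> (nat \<Rightarrow> bool) \<Rightarrow> complex" where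
  "dressed \<gamma> h \<mu> 0 u \<Psi> = Kaux h u \<Psi>"
| "dressed \<gamma> h \<mu> (Suc n) u \<Psi> =
     Rsite \<gamma> (u - \<mu> (Suc n)) (Suc n) (dressed \<gamma> h \<mu> n u (Rsite \<gamma> (u + \<mu> (Suc n)) (Suc n) \<Psi>))"

text \<open>Expand and use \<open>cosh x ^ 2 = 1 + sinh x ^ 2\<close> once. By substitution this
  relation yields most of the scalar identities needed below.\<close>

lemma sinh_three_term:
  fixes x y z :: complex
  shows "sinh (x + y) * sinh (x + z) = sinh x * sinh (x + y + z) + sinh y * sinh z"
  unfolding sinh_add cosh_add using hyperbolic_pythagoras[of x] by algebra

text \<open>The Yang-Baxter equation with the \<open>R\<close>-matrix of the two auxiliary spaces,
  at the sum of the parameters, in the middle. The eight choices of three spins need only three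
  arrangements of the three-term relation.\<close>

lemma yang_baxter_add:
  "on1 (Rsite \<gamma> u m) (Raux \<gamma> (u + v) (on2 (Rsite \<gamma> v m) \<Phi>)) =
   on2 (Rsite \<gamma> v m) (Raux \<gamma> (u + v) (on1 (Rsite \<gamma> u m) \<Phi>))"
proof (intro ext)
  fix a b s
  have "sinh (u + v) * sinh (u + \<gamma>) = sinh u * sinh (u + v + \<gamma>) + sinh v * sinh \<gamma>"
    "sinh (u + v) * sinh (v + \<gamma>) = sinh v * sinh (u + v + \<gamma>) + sinh u * sinh \<gamma>"
    "sinh (u + \<gamma>) * sinh (v + \<gamma>) = sinh \<gamma> * sinh (u + v + \<gamma>) + sinh u * sinh v"
    using sinh_three_term[of u v \<gamma>] sinh_three_term[of v u \<gamma>] sinh_three_term[of \<gamma> u v]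
    by (simp_all add: ac_simps)
  then show "on1 (Rsite \<gamma> u m) (Raux \<gamma> (u + v) (on2 (Rsite \<gamma> v m) \<Phi>)) a b s =
   on2 (Rsite \<gamma> v m) (Raux \<gamma> (u + v) (on1 (Rsite \<gamma> u m) \<Phi>)) a b s"
    by (cases a; cases b; cases "s m"; simp add: on1_def on2_def Rsite_def Raux_def fun_upd_idem; algebra)
qed

lemma yang_baxter_diff:
  "Raux \<gamma> (u - v) (on1 (Rsite \<gamma> u m) (on2 (Rsite \<gamma> v m) \<Phi>)) =
   on2 (Rsite \<gamma> v m) (on1 (Rsite \<gamma> u m) (Raux \<gamma> (u - v) \<Phi>))"
proof (intro ext)
  fix a b s
  \<comment> \<open>In terms of \<open>w\<close> the same three scalar relations as in
    \<open>yang_baxter_add\<close> suffice.\<close>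
  define w where "w = u - v"
  have u: "u = w + v" by (simp add: w_def)
  have "sinh (w + v) * sinh (w + \<gamma>) = sinh w * sinh (w + v + \<gamma>) + sinh v * sinh \<gamma>"
    "sinh (w + v) * sinh (v + \<gamma>) = sinh v * sinh (w + v + \<gamma>) + sinh w * sinh \<gamma>"
    "sinh (w + \<gamma>) * sinh (v + \<gamma>) = sinh \<gamma> * sinh (w + v + \<gamma>) + sinh w * sinh v"
    using sinh_three_term[of w v \<gamma>] sinh_three_term[of v w \<gamma>] sinh_three_term[of \<gamma> w v]
    by (simp_all add: ac_simps)
  then show "Raux \<gamma> (u - v) (on1 (Rsite \<gamma> u m) (on2 (Rsite \<gamma> v m) \<Phi>)) a b s =
   on2 (Rsite \<gamma> v m) (on1 (Rsite \<gamma> u m) (Raux \<gamma> (u - v) \<Phi>)) a b s"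
    unfolding w_def [symmetric] unfolding u
    by (cases a; cases b; cases "s m"; simp add: on1_def on2_def Rsite_def Raux_def fun_upd_idem; algebra)
qed

text \<open>Since \<open>Kaux\<close> is diagonal, comparing entries needs only two product
  identities for the boundary weights.\<close>

lemma reflection_Kaux:
  "Raux \<gamma> (u - v) (on1 (Kaux h u) (Raux \<gamma> (u + v) (on2 (Kaux h v) \<Phi>))) =
   on2 (Kaux h v) (Raux \<gamma> (u + v) (on1 (Kaux h u) (Raux \<gamma> (u - v) \<Phi>)))"
proof (intro ext)
  fix a b s
  have *: "sinh (h + u) * sinh (h + v) - sinh (h - u) * sinh (h - v) = sinh (2 * h) * sinh (u + v)"
    "sinh (h + u) * sinh (h - v) - sinh (h - u) * sinh (h + v) = sinh (2 * h) * sinh (u - v)"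
    unfolding mult_2 sinh_add cosh_add sinh_diff cosh_diff
    using hyperbolic_pythagoras[of h] hyperbolic_pythagoras[of u] hyperbolic_pythagoras[of v] by algebra+
  show "Raux \<gamma> (u - v) (on1 (Kaux h u) (Raux \<gamma> (u + v) (on2 (Kaux h v) \<Phi>))) a b s =
   on2 (Kaux h v) (Raux \<gamma> (u + v) (on1 (Kaux h u) (Raux \<gamma> (u - v) \<Phi>))) a b s"
    using * by (cases a; cases b; simp add: on1_def on2_def Kaux_def Raux_def; algebra)
qed

section \<open>Commutation at different sites, and the dressing induction\<close>

lemma on1_Rsite_on2_Rsite_commute:
  assumes "m \<noteq> k"
  shows "on1 (Rsite \<gamma> u m) (on2 (Rsite \<gamma>' v k) \<Phi>) = on2 (Rsite \<gamma>' v k) (on1 (Rsite \<gamma> u m) \<Phi>)"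
  using assms
  by (intro ext) (simp add: on1_def on2_def Rsite_def fun_upd_twist algebra_simps)

text \<open>The first \<open>n\<close> dressing layers act on sites \<open>1..n\<close> only, and
  the two operators use different auxiliary spaces.\<close>

lemma on1_dressed_on2_Rsite_commute:
  assumes "n < m"
  shows "on1 (dressed \<gamma> h \<mu> n u) (on2 (Rsite \<gamma>' v m) \<Phi>) = on2 (Rsite \<gamma>' v m) (on1 (dressed \<gamma> h \<mu> n u) \<Phi>)"
  using assms
proof (induction n arbitrary: \<Phi>)
  case 0
  show ?case
    by (intro ext) (simp add: on1_def on2_def Rsite_def Kaux_def algebra_simps)
next
  case (Suc n)
  have eq: "on1 (dressed \<gamma> h \<mu> (Suc n) u) \<Phi> = on1 (Rsite \<gamma> (u - \<mu> (Suc n)) (Suc n))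
     (on1 (dressed \<gamma> h \<mu> n u) (on1 (Rsite \<gamma> (u + \<mu> (Suc n)) (Suc n)) \<Phi>))" for \<Phi>
    by (intro ext) (simp add: on1_def)
  show ?case
    unfolding eq using Suc by (simp add: on1_Rsite_on2_Rsite_commute)
qed

lemma on2_dressed_on1_Rsite_commute:
  assumes "n < m"
  shows "on2 (dressed \<gamma> h \<mu> n u) (on1 (Rsite \<gamma>' v m) \<Phi>) = on1 (Rsite \<gamma>' v m) (on2 (dressed \<gamma> h \<mu> n u) \<Phi>)"
proof -
  \<comment> \<open>Interchanging the two auxiliary spaces reduces the claim to
    \<open>on1_dressed_on2_Rsite_commute\<close>.\<close>
  have swap: "on2 F \<Phi> = (\<lambda>a b. on1 F (\<lambda>a b. \<Phi> b a) b a)" for F and \<Phi> :: "bool \<Rightarrow> bool \<Rightarrow> (nat \<Rightarrow> bool) \<Rightarrow> complex"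
    by (intro ext) (simp add: on1_def on2_def)
  have swap': "on1 F \<Phi> = (\<lambda>a b. on2 F (\<lambda>a b. \<Phi> b a) b a)" for F and \<Phi> :: "bool \<Rightarrow> bool \<Rightarrow> (nat \<Rightarrow> bool) \<Rightarrow> complex"
    by (intro ext) (simp add: on1_def on2_def)
  show ?thesis
    unfolding swap[of "dressed \<gamma> h \<mu> n u"] swap'[of "Rsite \<gamma>' v m"]
    by (simp add: on1_dressed_on2_Rsite_commute[OF assms])
qed

text \<open>Induction on the dressing layers. The Yang-Baxter equation carries the four
  \<open>R\<close> factors of the new site through \<open>Raux\<close>, exposing the inner
  reflection equation, and then restores their places on the other side.\<close>

lemma reflection_dressed:
  "Raux \<gamma> (u - v) (on1 (dressed \<gamma> h \<mu> n u) (Raux \<gamma> (u + v) (on2 (dressed \<gamma> h \<mu> n v) \<Phi>))) =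
   on2 (dressed \<gamma> h \<mu> n v) (Raux \<gamma> (u + v) (on1 (dressed \<gamma> h \<mu> n u) (Raux \<gamma> (u - v) \<Phi>)))"
proof (induction n arbitrary: \<Phi>)
  case 0
  have "dressed \<gamma> h \<mu> 0 u = Kaux h u" for u
    by (rule ext) simp
  then show ?case
    by (simp only: reflection_Kaux)
next
  case (Suc n)
  let ?m = "Suc n"
  let ?T1 = "on1 (dressed \<gamma> h \<mu> n u)" and ?T2 = "on2 (dressed \<gamma> h \<mu> n v)"
  let ?R1 = "\<lambda>w. on1 (Rsite \<gamma> w ?m)" and ?R2 = "\<lambda>w. on2 (Rsite \<gamma> w ?m)"
  let ?Rm = "Raux \<gamma> (u - v)" and ?Rp = "Raux \<gamma> (u + v)"
  let ?c = "\<mu> ?m"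
  have eq1: "on1 (dressed \<gamma> h \<mu> (Suc n) u) \<Phi> = ?R1 (u - ?c) (?T1 (?R1 (u + ?c) \<Phi>))" for \<Phi>
    by (intro ext) (simp add: on1_def)
  have eq2: "on2 (dressed \<gamma> h \<mu> (Suc n) v) \<Phi> = ?R2 (v - ?c) (?T2 (?R2 (v + ?c) \<Phi>))" for \<Phi>
    by (intro ext) (simp add: on2_def)
  have c1: "?T1 (?R2 w \<Phi>) = ?R2 w (?T1 \<Phi>)" and c2: "?T2 (?R1 w \<Phi>) = ?R1 w (?T2 \<Phi>)" for w \<Phi>
    by (simp_all add: on1_dressed_on2_Rsite_commute on2_dressed_on1_Rsite_commute)
  have ya: "?R1 (u + ?c) (?Rp (?R2 (v - ?c) \<Phi>)) = ?R2 (v - ?c) (?Rp (?R1 (u + ?c) \<Phi>))" for \<Phi>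
    using yang_baxter_add[of \<gamma> "u + ?c" ?m "v - ?c"] by simp
  have ya': "?R1 (u - ?c) (?Rp (?R2 (v + ?c) \<Phi>)) = ?R2 (v + ?c) (?Rp (?R1 (u - ?c) \<Phi>))" for \<Phi>
    using yang_baxter_add[of \<gamma> "u - ?c" ?m "v + ?c"] by simp
  have yd: "?Rm (?R1 (u - ?c) (?R2 (v - ?c) \<Phi>)) = ?R2 (v - ?c) (?R1 (u - ?c) (?Rm \<Phi>))" for \<Phi>
    using yang_baxter_diff[of \<gamma> "u - ?c" "v - ?c" ?m] by simp
  have yd': "?Rm (?R1 (u + ?c) (?R2 (v + ?c) \<Phi>)) = ?R2 (v + ?c) (?R1 (u + ?c) (?Rm \<Phi>))" for \<Phi>
    using yang_baxter_diff[of \<gamma> "u + ?c" "v + ?c" ?m] by simp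
  have "?Rm (?R1 (u - ?c) (?T1 (?R1 (u + ?c) (?Rp (?R2 (v - ?c) (?T2 (?R2 (v + ?c) \<Phi>))))))) =
        ?R2 (v - ?c) (?R1 (u - ?c) (?Rm (?T1 (?Rp (?T2 (?R1 (u + ?c) (?R2 (v + ?c) \<Phi>)))))))"
    by (simp only: ya c1 c2 yd)
  also have "\<dots> = ?R2 (v - ?c) (?R1 (u - ?c) (?T2 (?Rp (?T1 (?R2 (v + ?c) (?R1 (u + ?c) (?Rm \<Phi>)))))))"
    by (simp only: Suc.IH yd')
  also have "\<dots> = ?R2 (v - ?c) (?T2 (?R2 (v + ?c) (?Rp (?R1 (u - ?c) (?T1 (?R1 (u + ?c) (?Rm \<Phi>)))))))"
    by (simp only: c1 c2[symmetric] ya')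
  finally show ?case
    unfolding eq1 eq2 .
qed

section \<open>Exchange relations\<close>

lemma Rsite_lincomb:
  "Rsite \<gamma> u m (\<lambda>a s. c * \<Phi> a s + \<Psi> a s) = (\<lambda>a s. c * Rsite \<gamma> u m \<Phi> a s + Rsite \<gamma> u m \<Psi> a s)"
  by (intro ext) (simp add: Rsite_def algebra_simps)

lemma dressed_lincomb:
  "dressed \<gamma> h \<mu> n u (\<lambda>a s. c * \<Phi> a s + \<Psi> a s) =
   (\<lambda>a s. c * dressed \<gamma> h \<mu> n u \<Phi> a s + dressed \<gamma> h \<mu> n u \<Psi> a s)"
proof (induction n arbitrary: \<Phi> \<Psi>)
  case 0
  show ?case by (intro ext) (simp add: Kaux_def algebra_simps)
next
  case (Suc n)
  then show ?case by (simp add: Rsite_lincomb)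
qed

text \<open>The vector \<open>\<Psi>\<close> may depend on \<open>u\<close> as well, so the lemma
  applies to nested products in which an inner operator carries the varying parameter.\<close>

lemma continuous_on_dressed:
  assumes "\<And>a s. continuous_on UNIV (\<lambda>u. \<Psi> u a s)" and w: "continuous_on UNIV w"
  shows "continuous_on UNIV (\<lambda>u. dressed \<gamma> h \<mu> n (w u) (\<Psi> u) a s)"
  using assms(1)
proof (induction n arbitrary: \<Psi> a s)
  case 0
  with w show ?case by (cases a) (auto simp: Kaux_def intro!: continuous_intros)
next
  case (Suc n)
  have R: "continuous_on UNIV (\<lambda>u. Rsite \<gamma> (w u) m (\<Psi> u) a s)"
    if "\<And>a s. continuous_on UNIV (\<lambda>u. \<Psi> u a s)" "continuous_on UNIV w" for w \<Psi> m a s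
    using that by (cases "a = s m") (auto simp: Rsite_def intro!: continuous_intros)
  show ?case
    by (simp, intro R Suc.IH Suc.prems continuous_intros w)
qed

text \<open>A zero forces \<open>exp z = exp (- z)\<close>; comparing moduli leaves only imaginary
  \<open>z\<close>.\<close>

lemma sinh_zero_imp_Re_zero: "Re z = 0" if "sinh z = 0" for z :: complex
proof -
  have "exp z = exp (- z)"
    using that by (simp add: sinh_def)
  then have "norm (exp z) = norm (exp (- z))" by simp
  then show ?thesis by simp
qed

text \<open>
  Along a horizontal line through \<open>u\<close> the factors have at most one zero each, as \<open>sinh\<close> vanishes
  on the imaginary axis only.
\<close>

lemma continuous_sinh_mult_eq_0:
  fixes G :: "complex \<Rightarrow> complex"
  assumes cont: "continuous_on UNIV G"
    and zero: "\<And>u. sinh (u + p) * sinh (u + q) * G u = 0"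
  shows "G u = 0"
proof -
  have ev: "\<forall>\<^sub>F t in at_right (0::real). sinh (u + of_real t + p) \<noteq> 0" for p
  proof -
    have "\<forall>\<^sub>F t in at_right (0::real). t \<noteq> - Re (u + p)"
      by (rule eventually_neq_at_within)
    then show ?thesis
      by eventually_elim (use sinh_zero_imp_Re_zero in fastforce)
  qed
  \<comment> \<open>Both factors are nonzero for small \<open>t > 0\<close>, so \<open>G\<close>
    vanishes there; continuity at \<open>t = 0\<close> then gives \<open>G u = 0\<close>.\<close>
  have "\<forall>\<^sub>F t in at_right (0::real). G (u + of_real t) = 0"
    using ev[of p] ev[of q] by eventually_elim (use zero in fastforce)
  then have "((\<lambda>t. G (u + of_real t)) \<longlongrightarrow> 0) (at_right (0::real))"
    by (rule tendsto_eventually)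
  moreover have "continuous_on UNIV (\<lambda>t::real. G (u + of_real t))"
    by (intro continuous_on_compose2[OF cont] continuous_intros) auto
  then have "((\<lambda>t::real. G (u + of_real t)) \<longlongrightarrow> G (u + of_real 0)) (at_right 0)"
    by (meson UNIV_I continuous_on_def filterlim_at_split)
  ultimately show ?thesis
    using tendsto_unique[OF trivial_limit_at_right_real] by fastforce
qed

section \<open>Blocks of the double-row monodromy matrix as operators on the chain\<close>

definition entry :: "complex \<Rightarrow> complex \<Rightarrow> (nat \<Rightarrow> complex) \<Rightarrow> nat \<Rightarrow> bool \<Rightarrow> bool \<Rightarrow> complex \<Rightarrow> ((nat \<Rightarrow> bool) \<Rightarrow> complex) \<Rightarrow> (nat \<Rightarrow> bool) \<Rightarrow> complex" where
  "entry \<gamma> h \<mu> L i j u \<psi> = dressed \<gamma> h \<mu> L u (\<lambda>k. if k = j then \<psi> else (\<lambda>_. 0)) i"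

context
  fixes \<gamma> h :: complex and \<mu> :: "nat \<Rightarrow> complex" and L :: nat
begin

abbreviation opA where "opA \<equiv> entry \<gamma> h \<mu> L False False"
abbreviation opB where "opB \<equiv> entry \<gamma> h \<mu> L False True"
abbreviation opD where "opD \<equiv> entry \<gamma> h \<mu> L True True"

definition opDt where "opDt u \<psi> s = opD u \<psi> s - sinh \<gamma> / sinh (2 * u + \<gamma>) * opA u \<psi> s"

lemma entry_lincomb:
  "entry \<gamma> h \<mu> L i j u (\<lambda>s. c * \<phi> s + \<psi> s) = (\<lambda>s. c * entry \<gamma> h \<mu> L i j u \<phi> s + entry \<gamma> h \<mu> L i j u \<psi> s)"
proof -
  have "(\<lambda>k. if k = j then (\<lambda>s. c * \<phi> s + \<psi> s) else (\<lambda>_. 0)) =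
     (\<lambda>k s. c * (if k = j then \<phi> else (\<lambda>_. 0)) s + (if k = j then \<psi> else (\<lambda>_. 0)) s)"
    by auto
  then show ?thesis
    by (simp add: entry_def dressed_lincomb)
qed

lemma entry_zero: "entry \<gamma> h \<mu> L i j u (\<lambda>_. 0) = (\<lambda>_. 0)"
  \<comment> \<open>With scalar -1 and zero vectors the two terms on the right cancel.\<close>
  using entry_lincomb[of i j u "-1" "\<lambda>_. 0" "\<lambda>_. 0"] by (simp add: fun_eq_iff)

lemma entry_scale: "entry \<gamma> h \<mu> L i j u (\<lambda>s. c * \<phi> s) = (\<lambda>s. c * entry \<gamma> h \<mu> L i j u \<phi> s)"
  using entry_lincomb[of i j u c \<phi> "\<lambda>_. 0"] by (simp add: entry_zero)

lemma entry_add: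
  "entry \<gamma> h \<mu> L i j u (\<lambda>s. \<phi> s + \<psi> s) = (\<lambda>s. entry \<gamma> h \<mu> L i j u \<phi> s + entry \<gamma> h \<mu> L i j u \<psi> s)"
  using entry_lincomb[of i j u 1 \<phi> \<psi>] by simp

lemma entry_sum:
  "entry \<gamma> h \<mu> L i j u (\<lambda>s. \<Sum>z\<in>S. c z * \<phi> z s) = (\<lambda>s. \<Sum>z\<in>S. c z * entry \<gamma> h \<mu> L i j u (\<phi> z) s)"
  by (induction S rule: infinite_finite_induct) (simp_all add: entry_zero entry_lincomb)

lemma dressed_entries:
  "dressed \<gamma> h \<mu> L u \<Psi> a =
   (\<lambda>s. entry \<gamma> h \<mu> L a False u (\<Psi> False) s + entry \<gamma> h \<mu> L a True u (\<Psi> True) s)"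
proof -
  let ?e = "\<lambda>j k. if k = j then \<Psi> j else (\<lambda>_. 0)"
  have "\<Psi> = (\<lambda>a s. 1 * ?e False a s + ?e True a s)"
    by (intro ext) (auto split: bool.split)
  then have "dressed \<gamma> h \<mu> L u \<Psi> = dressed \<gamma> h \<mu> L u (\<lambda>a s. 1 * ?e False a s + ?e True a s)"
    by (rule arg_cong)
  then show ?thesis
    by (simp only: dressed_lincomb) (simp add: entry_def)
qed

lemma continuous_on_entry:
  assumes "\<And>s. continuous_on UNIV (\<lambda>u. \<psi> u s)" "continuous_on UNIV w"
  shows "continuous_on UNIV (\<lambda>u. entry \<gamma> h \<mu> L i j (w u) (\<psi> u) s)"
proof -
  have "continuous_on UNIV (\<lambda>u. (if a = j then \<psi> u else (\<lambda>_. 0)) s)" for a s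
    using assms by (cases "a = j") auto
  then show ?thesis
    unfolding entry_def using assms by (intro continuous_on_dressed)
qed

lemma Raux_cases:
  "Raux \<gamma> u \<Phi> False False = (\<lambda>s. sinh (u + \<gamma>) * \<Phi> False False s)"
  "Raux \<gamma> u \<Phi> True True = (\<lambda>s. sinh (u + \<gamma>) * \<Phi> True True s)"
  "Raux \<gamma> u \<Phi> False True = (\<lambda>s. sinh u * \<Phi> False True s + sinh \<gamma> * \<Phi> True False s)"
  "Raux \<gamma> u \<Phi> True False = (\<lambda>s. sinh u * \<Phi> True False s + sinh \<gamma> * \<Phi> False True s)"
  by (simp_all add: Raux_def fun_eq_iff)

lemma on1_dressed:
  "on1 (dressed \<gamma> h \<mu> L u) \<Phi> a b =
   (\<lambda>s. entry \<gamma> h \<mu> L a False u (\<Phi> False b) s + entry \<gamma> h \<mu> L a True u (\<Phi> True b) s)"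
  by (simp add: on1_def dressed_entries)

lemma on2_dressed:
  "on2 (dressed \<gamma> h \<mu> L u) \<Phi> a b =
   (\<lambda>s. entry \<gamma> h \<mu> L b False u (\<Phi> a False) s + entry \<gamma> h \<mu> L b True u (\<Phi> a True) s)"
  by (simp add: on2_def dressed_entries)

lemmas entry_simps = Raux_cases on1_dressed on2_dressed entry_zero entry_scale entry_add

text \<open>One matrix element of \<open>reflection_dressed\<close>: a vector supported on one pair
  of auxiliary states selects the column, and the two Boolean instantiations select the row. The
  next two lemmas read off other elements in the same way.\<close>

lemma exchange_BB_mult:
  "sinh (u - v + \<gamma>) * sinh (u + v) * (opB u (opB v \<psi>) s - opB v (opB u \<psi>) s) = 0"
  using fun_cong[OF fun_cong[OF fun_cong[OF reflection_dressed[of \<gamma> u v h \<mu> L "\<lambda>a b. if a \<and> b then \<psi> else (\<lambda>_. 0)"], of False], of False], of s]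
  by (simp add: entry_simps)

lemma exchange_AB_mult:
  "sinh (u + v + \<gamma>) * sinh (u - v) * opA v (opB u \<psi>) s =
   sinh (u - v + \<gamma>) * sinh (u + v) * opB u (opA v \<psi>) s
   - sinh \<gamma> * sinh (u + v) * opB v (opA u \<psi>) s - sinh \<gamma> * sinh (u - v) * opB v (opD u \<psi>) s"
  using fun_cong[OF fun_cong[OF fun_cong[OF reflection_dressed[of \<gamma> u v h \<mu> L "\<lambda>a b. if a \<and> \<not> b then \<psi> else (\<lambda>_. 0)"], of False], of False], of s]
  by (simp add: entry_simps) algebra

lemma exchange_DB_mult:
  "sinh (u - v) * sinh (u + v) * opD u (opB v \<psi>) s = 
   sinh (u - v + \<gamma>) * sinh \<gamma> * opA v (opB u \<psi>) s + sinh (u - v + \<gamma>) * sinh (u + v + \<gamma>) * opB v (opD u \<psi>) s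
   - (sinh \<gamma>)\<^sup>2 * opA u (opB v \<psi>) s - sinh \<gamma> * sinh (u + v + \<gamma>) * opB u (opD v \<psi>) s"
  using fun_cong[OF fun_cong[OF fun_cong[OF reflection_dressed[of \<gamma> u v h \<mu> L "\<lambda>a b. if a \<and> b then \<psi> else (\<lambda>_. 0)"], of True], of False], of s]
  by (simp add: entry_simps) algebra

text \<open>\<open>exchange_BB_mult\<close> gives this up to two factors of the form
  \<open>sinh (u + p)\<close>, which continuity in \<open>u\<close> removes, so no condition on the
  parameters remains.\<close>

lemma exchange_BB: "opB u (opB v \<psi>) = opB v (opB u \<psi>)"
proof
  fix s
  let ?G = "\<lambda>u. opB u (opB v \<psi>) s - opB v (opB u \<psi>) s"
  have cont: "continuous_on UNIV ?G"
    by (intro continuous_intros continuous_on_entry)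
  have zero: "sinh (u + (\<gamma> - v)) * sinh (u + v) * ?G u = 0" for u
    using exchange_BB_mult[of u v \<psi> s] by (simp add: algebra_simps)
  show "opB u (opB v \<psi>) s = opB v (opB u \<psi>) s"
    using continuous_sinh_mult_eq_0[OF cont zero] by simp
qed

text \<open>\<open>coef_f\<close> and \<open>coef_h\<close> belong to the wanted terms, in which the
  moving operator keeps its parameter \<open>x\<close>; \<open>coef_g\<close>,
  \<open>coef_w\<close>, \<open>coef_k\<close> and \<open>coef_n\<close> belong to the terms in
  which \<open>x\<close> and \<open>y\<close> are exchanged.\<close>

definition coef_f where
  "coef_f x y = sinh (y - x + \<gamma>) / sinh (y - x) * (sinh (y + x) / sinh (y + x + \<gamma>))"
definition coef_g where
  "coef_g x y = - (sinh (2 * y) / sinh (2 * y + \<gamma>) * (sinh \<gamma> / sinh (y - x)))"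
definition coef_w where
  "coef_w x y = - (sinh \<gamma> / sinh (y + x + \<gamma>))"
definition coef_h where
  "coef_h x y = sinh (x - y + \<gamma>) / sinh (x - y) * (sinh (x + y + 2 * \<gamma>) / sinh (x + y + \<gamma>))"
definition coef_k where
  "coef_k x y = - (sinh \<gamma> * sinh (2 * x + 2 * \<gamma>) / (sinh (2 * x + \<gamma>) * sinh (x - y)))"
definition coef_n where
  "coef_n x y = sinh \<gamma> * sinh (2 * x + 2 * \<gamma>) * sinh (2 * y) / (sinh (2 * x + \<gamma>) * sinh (2 * y + \<gamma>) * sinh (x + y + \<gamma>))"

lemma exchange_AB:
  assumes "sinh (y - x) \<noteq> 0" "sinh (y + x + \<gamma>) \<noteq> 0" "sinh (2 * y + \<gamma>) \<noteq> 0"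
  shows "opA x (opB y \<psi>) s = coef_f x y * opB y (opA x \<psi>) s
    + coef_g x y * opB x (opA y \<psi>) s + coef_w x y * opB x (opDt y \<psi>) s"
proof -
  have Dt: "opB x (opDt y \<psi>) s = opB x (opD y \<psi>) s - sinh \<gamma> / sinh (2 * y + \<gamma>) * opB x (opA y \<psi>) s"
    using entry_lincomb[of False True x "- (sinh \<gamma> / sinh (2 * y + \<gamma>))" "opA y \<psi>" "opD y \<psi>"]
    by (simp add: opDt_def[abs_def] fun_eq_iff)
  \<comment> \<open>Replacing \<open>opD y\<close> by \<open>opDt y\<close> produces a second
    \<open>opB x (opA y \<psi>)\<close> term; this relation merges the two into
    \<open>coef_g\<close>.\<close>
  have id: "sinh (y + x) * sinh (2 * y + \<gamma>) = sinh (2 * y) * sinh (y + x + \<gamma>) - sinh \<gamma> * sinh (y - x)"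
    using sinh_three_term[of "2 * y" "x - y" \<gamma>] sinh_minus[of "x - y"] by (simp add: algebra_simps)
  show ?thesis
    using exchange_AB_mult[of y x \<psi> s] assms id
    unfolding Dt coef_f_def coef_g_def coef_w_def
    by (simp add: divide_simps) algebra
qed

text \<open>In \<open>exchange_DB_mult\<close> two products with \<open>opA\<close> to the left of
  \<open>opB\<close> remain. \<open>exchange_AB_mult\<close>, used in both orders, eliminates them
  at the cost of factors that continuity in \<open>u\<close> removes.\<close>

lemma exchange_DtB_mult:
  "sinh (u + v + \<gamma>) * sinh (u - v) * sinh (2 * v + \<gamma>) *
     (sinh (2 * u + \<gamma>) * opD u (opB v \<psi>) s - sinh \<gamma> * opA u (opB v \<psi>) s) =
   sinh (2 * v + \<gamma>) * sinh (u - v + \<gamma>) * sinh (u + v + 2 * \<gamma>) *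
     (sinh (2 * u + \<gamma>) * opB v (opD u \<psi>) s - sinh \<gamma> * opB v (opA u \<psi>) s)
   - sinh \<gamma> * sinh (2 * u + 2 * \<gamma>) * sinh (u + v + \<gamma>) *
     (sinh (2 * v + \<gamma>) * opB u (opD v \<psi>) s - sinh \<gamma> * opB u (opA v \<psi>) s)
   + sinh (u - v) * sinh \<gamma> * sinh (2 * u + 2 * \<gamma>) * sinh (2 * v) * opB u (opA v \<psi>) s"
proof -
  define G where "G u = sinh (u + v + \<gamma>) * sinh (u - v) * sinh (2 * v + \<gamma>) *
     (sinh (2 * u + \<gamma>) * opD u (opB v \<psi>) s - sinh \<gamma> * opA u (opB v \<psi>) s) -
   (sinh (2 * v + \<gamma>) * sinh (u - v + \<gamma>) * sinh (u + v + 2 * \<gamma>) *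
     (sinh (2 * u + \<gamma>) * opB v (opD u \<psi>) s - sinh \<gamma> * opB v (opA u \<psi>) s)
   - sinh \<gamma> * sinh (2 * u + 2 * \<gamma>) * sinh (u + v + \<gamma>) *
     (sinh (2 * v + \<gamma>) * opB u (opD v \<psi>) s - sinh \<gamma> * opB u (opA v \<psi>) s)
   + sinh (u - v) * sinh \<gamma> * sinh (2 * u + 2 * \<gamma>) * sinh (2 * v) * opB u (opA v \<psi>) s)" for u
  have cont: "continuous_on UNIV G"
    unfolding G_def by (intro continuous_intros continuous_on_entry)
  have zero: "sinh (u + - v) * sinh (u + v) * G u = 0" for u
  proof -
    \<comment> \<open>Symbols for the \<open>sinh\<close> values and the operator products turn the
      goal into a polynomial elimination problem.\<close>
    define c P Q ap am bp bm am' s2 t q r where defs: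
      "c = sinh \<gamma>" "P = sinh (2 * u + \<gamma>)" "Q = sinh (2 * v + \<gamma>)"
      "ap = sinh (u + v + \<gamma>)" "am = sinh (u - v + \<gamma>)" "bp = sinh (u + v)" "bm = sinh (u - v)"
      "am' = sinh (v - u + \<gamma>)" "s2 = sinh (u + v + 2 * \<gamma>)" "t = sinh (2 * u + 2 * \<gamma>)"
      "q = sinh (2 * v)" "r = sinh (u - v + 2 * \<gamma>)"
    define DB AB A'B BvD BuD BvA BuA where ops:
      "DB = opD u (opB v \<psi>) s" "AB = opA u (opB v \<psi>) s" "A'B = opA v (opB u \<psi>) s"
      "BvD = opB v (opD u \<psi>) s" "BuD = opB u (opD v \<psi>) s"
      "BvA = opB v (opA u \<psi>) s" "BuA = opB u (opA v \<psi>) s"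
    have bm: "sinh (v - u) = - bm"
      using sinh_minus[of "u - v"] by (simp add: defs)
    have e1: "ap * bm * A'B = am * bp * BuA - c * bp * BvA - c * bm * BvD"
      using exchange_AB_mult[of u v \<psi> s] by (simp add: defs ops)
    have e2: "ap * bm * AB = - (am' * bp * BvA) + c * bp * BuA - c * bm * BuD"
      using exchange_AB_mult[of v u \<psi> s] bm by (simp add: defs ops add.commute[of v u] algebra_simps)
    have e3: "bm * bp * DB = am * c * A'B + am * ap * BvD - c\<^sup>2 * AB - c * ap * BuD"
      using exchange_DB_mult[of u v \<psi> s] by (simp add: defs ops)
    have i1: "ap * ap = c * c + bp * s2"
      using sinh_three_term[of "u + v" \<gamma> \<gamma>] by (simp add: defs algebra_simps)
    have i2: "P * s2 = c * bm + t * ap"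
      using sinh_three_term[of "u + v + \<gamma>" "u - v" \<gamma>] by (simp add: defs algebra_simps)
    \<comment> \<open>Here the three-term relation is supplemented by the doubling formula, through
      which \<open>cosh \<gamma>\<close> is eliminated.\<close>
    have i3: "P * c * (am' - am) + bm * bp * am' + bm * am * s2 = 0"
    proof -
      have "P * sinh (2 * \<gamma>) = am * s2 + bp * am'"
        using sinh_three_term[of "u - v + \<gamma>" "u + v" "v - u + \<gamma>"] by (simp add: defs algebra_simps)
      moreover have "am' - am = - (2 * bm * cosh \<gamma>)"
        using sinh_add[of "u - v" \<gamma>] sinh_add[of "v - u" \<gamma>] bm cosh_minus[of "u - v"]
        by (simp add: defs)
      moreover have "sinh (2 * \<gamma>) = 2 * c * cosh \<gamma>"
        by (simp add: defs sinh_double)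
      ultimately show ?thesis by algebra
    qed
    have i4: "am * am - c * c = bm * r"
      using sinh_three_term[of "u - v" \<gamma> \<gamma>] by (simp add: defs algebra_simps)
    have i5: "c * ap + bm * q = am * Q"
      using sinh_three_term[of \<gamma> "u - v" "2 * v"] by (simp add: defs algebra_simps)
    have i6: "P * r - c * bp - t * am = 0"
      using sinh_three_term[of "u - v + \<gamma>" "u + v" \<gamma>] by (simp add: defs algebra_simps)
    have "bm * bp * (ap * bm * Q * (P * DB - c * AB) - (Q * am * s2 * (P * BvD - c * BvA)
      - c * t * ap * (Q * BuD - c * BuA) + bm * c * t * q * BuA)) = 0"
      using e1 e2 e3 i1 i2 i3 i4 i5 i6 by algebra
    then show ?thesis
      by (simp add: G_def defs ops)
  qed
  show ?thesis
    using continuous_sinh_mult_eq_0[OF cont zero, of u] by (simp add: G_def)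
qed

lemma exchange_DtB:
  assumes "sinh (x - y) \<noteq> 0" "sinh (x + y + \<gamma>) \<noteq> 0" "sinh (2 * x + \<gamma>) \<noteq> 0" "sinh (2 * y + \<gamma>) \<noteq> 0"
  shows "opDt x (opB y \<psi>) s = coef_h x y * opB y (opDt x \<psi>) s
    + coef_k x y * opB x (opDt y \<psi>) s + coef_n x y * opB x (opA y \<psi>) s"
proof -
  have Dt: "opB z (opDt u \<psi>) s = opB z (opD u \<psi>) s - sinh \<gamma> / sinh (2 * u + \<gamma>) * opB z (opA u \<psi>) s" for u z
    using entry_lincomb[of False True z "- (sinh \<gamma> / sinh (2 * u + \<gamma>))" "opA u \<psi>" "opD u \<psi>"]
    by (simp add: opDt_def[abs_def] fun_eq_iff)
  define P Q ap bm am s2 t where defs: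
    "P = sinh (2 * x + \<gamma>)" "Q = sinh (2 * y + \<gamma>)" "ap = sinh (x + y + \<gamma>)" "bm = sinh (x - y)"
    "am = sinh (x - y + \<gamma>)" "s2 = sinh (x + y + 2 * \<gamma>)" "t = sinh (2 * x + 2 * \<gamma>)"
  have nz: "P \<noteq> 0" "Q \<noteq> 0" "ap \<noteq> 0" "bm \<noteq> 0"
    using assms by (simp_all add: defs)
  have "ap * bm * Q * (P * opD x (opB y \<psi>) s - sinh \<gamma> * opA x (opB y \<psi>) s) =
    Q * am * s2 * (P * opB y (opD x \<psi>) s - sinh \<gamma> * opB y (opA x \<psi>) s)
   - sinh \<gamma> * t * ap * (Q * opB x (opD y \<psi>) s - sinh \<gamma> * opB x (opA y \<psi>) s)
   + bm * sinh \<gamma> * t * sinh (2 * y) * opB x (opA y \<psi>) s"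
    using exchange_DtB_mult[of x y \<psi> s] by (simp add: defs)
  then show ?thesis
    unfolding Dt coef_h_def coef_k_def coef_n_def opDt_def[of x "opB y \<psi>"]
    unfolding defs [symmetric]
    using nz by (simp add: divide_simps) algebra
qed

section \<open>Identities between the exchange coefficients\<close>

lemma coef_identity_mult:
  "sinh (2 * y + \<gamma>) * (sinh (y - x + \<gamma>) * sinh (y + x) * (sinh (z - y) * sinh (y + z + \<gamma>))
     + sinh (y - z + \<gamma>) * sinh (y + z) * (sinh (y - x) * sinh (y + x + \<gamma>))) =
   sinh \<gamma> * sinh (z - x) * (sinh (2 * y) * sinh (y + x + \<gamma>) * sinh (y + z + \<gamma>)
     - sinh (2 * y + 2 * \<gamma>) * sinh (y - x) * sinh (z - y))"
proof -
  have neg: "sinh (y - z) = - sinh (z - y)" "sinh (x - z) = - sinh (z - x)"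
    using sinh_minus[of "z - y"] sinh_minus[of "z - x"] by simp_all
  \<comment> \<open>This splits the numerator of each \<open>coef_f\<close>; the first parts cancel
    between the two summands, leaving a multiple of \<open>sinh \<gamma>\<close>.\<close>
  have *: "sinh (y - w + \<gamma>) * sinh (y + w) = sinh (y - w) * sinh (y + w + \<gamma>) + sinh \<gamma> * sinh (2 * w)" for w
    using sinh_three_term[of "y - w" \<gamma> "2 * w"] by (simp add: algebra_simps)
  have **: "sinh (2 * y + \<gamma>) * sinh (2 * w) = sinh (y + w) * sinh (y + w + \<gamma>) - sinh (y - w) * sinh (y - w + \<gamma>)" for w
    using sinh_three_term[of "y + w" "y - w + \<gamma>" "w - y"] sinh_minus[of "w - y"] by (simp add: algebra_simps)
  \<comment> \<open>After \<open>**\<close> the remainder regroups into two brackets; relations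
    \<open>1\<close> and \<open>2\<close> extract the factor \<open>sinh (z - x)\<close> from
    them.\<close>
  have 1: "sinh (z - y) * sinh (y + x) + sinh (y - x) * sinh (y + z) = sinh (z - x) * sinh (2 * y)"
    using sinh_three_term[of "y - x" "z - y" "y + x"] by (simp add: algebra_simps)
  have 2: "sinh (y + x + \<gamma>) * sinh (y - z + \<gamma>) - sinh (y + z + \<gamma>) * sinh (y - x + \<gamma>)
     = - (sinh (2 * y + 2 * \<gamma>) * sinh (z - x))"
    using sinh_three_term[of "z - x" "y + x + \<gamma>" "y - z + \<gamma>"] by (simp add: algebra_simps)
  have "sinh (2 * y + \<gamma>) * (sinh (2 * x) * (sinh (z - y) * sinh (y + z + \<gamma>))
     + sinh (2 * z) * (sinh (y - x) * sinh (y + x + \<gamma>))) =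
    sinh (z - x) * (sinh (2 * y) * sinh (y + x + \<gamma>) * sinh (y + z + \<gamma>)
     - sinh (2 * y + 2 * \<gamma>) * sinh (y - x) * sinh (z - y))"
    using **[of x] **[of z] 1 2 neg by algebra
  then show ?thesis
    using *[of x] *[of z] neg by algebra
qed

text \<open>This is the first identity of \<open>coef_identities\<close> with its common factor
  \<open>- (sinh \<gamma> * sinh (2 * z) / sinh (2 * z + \<gamma>))\<close> removed.\<close>

lemma coef_identity:
  assumes "sinh (y - x) \<noteq> 0" "sinh (z - x) \<noteq> 0" "sinh (z - y) \<noteq> 0"
    "sinh (y + x + \<gamma>) \<noteq> 0" "sinh (y + z + \<gamma>) \<noteq> 0" "sinh (2 * y + \<gamma>) \<noteq> 0"
  shows "coef_f x y / sinh (z - x)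
     - sinh \<gamma> * sinh (2 * y) / (sinh (2 * y + \<gamma>) * sinh (y - x) * sinh (z - y))
     + sinh \<gamma> * sinh (2 * y + 2 * \<gamma>) / (sinh (2 * y + \<gamma>) * sinh (y + x + \<gamma>) * sinh (y + z + \<gamma>))
     = coef_f z y / sinh (z - x)"
proof -
  have neg: "sinh (y - z) = - sinh (z - y)"
    using sinh_minus[of "z - y"] by simp
  show ?thesis
    unfolding coef_f_def neg
    using assms coef_identity_mult[of y x z] by (simp add: divide_simps) algebra
qed

text \<open>Crossing symmetry, which lets one scalar identity serve for moving both
  \<open>opA\<close> and \<open>opDt\<close>.\<close>

lemma coef_h_conv_coef_f: "coef_h x y = coef_f (- x - \<gamma>) y"
proof -
  have "sinh (x - y + \<gamma>) = - sinh (y - x - \<gamma>)" "sinh (x - y) = - sinh (y - x)"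
    using sinh_minus[of "x - y + \<gamma>"] sinh_minus[of "x - y"] by simp_all
  then show ?thesis
    unfolding coef_h_def coef_f_def by (simp add: algebra_simps)
qed

text \<open>
  Consistency of the coefficients: they make the unwanted terms arising from two successive exchanges
  agree with those from a single exchange after reordering the \<open>B\<close> operators. The last three
  identities are images of the first under the crossings \<open>z \<mapsto> - z - \<gamma>\<close> and \<open>x \<mapsto> - x - \<gamma>\<close>.
\<close>

lemma coef_identities:
  assumes "sinh (y - x) \<noteq> 0" "sinh (z - x) \<noteq> 0" "sinh (z - y) \<noteq> 0"
    "sinh (y + x + \<gamma>) \<noteq> 0" "sinh (z + x + \<gamma>) \<noteq> 0" "sinh (z + y + \<gamma>) \<noteq> 0"
    "sinh (2 * x + \<gamma>) \<noteq> 0" "sinh (2 * y + \<gamma>) \<noteq> 0" "sinh (2 * z + \<gamma>) \<noteq> 0"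
  shows "coef_f x y * coef_g x z + coef_g x y * coef_g y z + coef_w x y * coef_n y z = coef_g x z * coef_f z y" (is ?AA)
    "coef_f x y * coef_w x z + coef_g x y * coef_w y z + coef_w x y * coef_k y z = coef_w x z * coef_h z y" (is ?AD)
    "coef_h x y * coef_k x z + coef_k x y * coef_k y z + coef_n x y * coef_w y z = coef_k x z * coef_h z y" (is ?DD)
    "coef_h x y * coef_n x z + coef_k x y * coef_n y z + coef_n x y * coef_g y z = coef_n x z * coef_f z y" (is ?DA)
proof -
  have neg: "sinh (x - y) = - sinh (y - x)" "sinh (x - z) = - sinh (z - x)" "sinh (y - z) = - sinh (z - y)"
    "sinh (- z - \<gamma> - x) = - sinh (z + x + \<gamma>)" "sinh (- z - \<gamma> - y) = - sinh (z + y + \<gamma>)"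
    "sinh (- z - \<gamma> - (- x - \<gamma>)) = - sinh (z - x)"
    unfolding sinh_minus[symmetric] by (rule arg_cong[where f = sinh], simp)+
  have pos: "sinh (z - (- x - \<gamma>)) = sinh (z + x + \<gamma>)" "sinh (y - (- x - \<gamma>)) = sinh (y + x + \<gamma>)"
    by (simp_all add: algebra_simps)
  define c qy qz ty tx Px Py Pz Bxy Bxz Byz Axy Axz Ayz where defs:
    "c = sinh \<gamma>" "qy = sinh (2 * y)" "qz = sinh (2 * z)" "ty = sinh (2 * y + 2 * \<gamma>)" "tx = sinh (2 * x + 2 * \<gamma>)"
    "Px = sinh (2 * x + \<gamma>)" "Py = sinh (2 * y + \<gamma>)" "Pz = sinh (2 * z + \<gamma>)"
    "Bxy = sinh (y - x)" "Bxz = sinh (z - x)" "Byz = sinh (z - y)"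
    "Axy = sinh (y + x + \<gamma>)" "Axz = sinh (z + x + \<gamma>)" "Ayz = sinh (z + y + \<gamma>)"
  have g: "coef_g x y = - (qy / Py * (c / Bxy))" "coef_g x z = - (qz / Pz * (c / Bxz))" "coef_g y z = - (qz / Pz * (c / Byz))"
    and w: "coef_w x y = - (c / Axy)" "coef_w x z = - (c / Axz)" "coef_w y z = - (c / Ayz)"
    and k: "coef_k x y = c * tx / (Px * Bxy)" "coef_k x z = c * tx / (Px * Bxz)" "coef_k y z = c * ty / (Py * Byz)"
    and n: "coef_n x y = c * tx * qy / (Px * Py * Axy)" "coef_n x z = c * tx * qz / (Px * Pz * Axz)"
       "coef_n y z = c * ty * qz / (Py * Pz * Ayz)"
    unfolding coef_g_def coef_w_def coef_k_def coef_n_def neg by (simp_all add: defs ac_simps)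
  have 1: "coef_f x y / Bxz - c * qy / (Py * Bxy * Byz) + c * ty / (Py * Axy * Ayz) = coef_f z y / Bxz"
    using coef_identity[of y x z] assms by (simp add: defs ac_simps)
  have 2: "coef_f x y / Axz - c * qy / (Py * Bxy * Ayz) + c * ty / (Py * Axy * Byz) = coef_h z y / Axz"
    using coef_identity[of y x "- z - \<gamma>"] assms neg
    by (simp add: defs ac_simps coef_h_conv_coef_f) algebra
  have 3: "coef_h x y / Axz - c * qy / (Py * Axy * Byz) + c * ty / (Py * Bxy * Ayz) = coef_f z y / Axz"
    using coef_identity[of y "- x - \<gamma>" z] assms neg pos
    by (simp add: defs ac_simps coef_h_conv_coef_f)
  have 4: "coef_h x y / Bxz - c * qy / (Py * Axy * Ayz) + c * ty / (Py * Bxy * Byz) = coef_h z y / Bxz"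
    using coef_identity[of y "- x - \<gamma>" "- z - \<gamma>"] assms neg pos
    by (simp add: defs ac_simps coef_h_conv_coef_f) algebra
  \<comment> \<open>Each goal is one of \<open>1\<close> to \<open>4\<close> times a factor common
    to all its terms. Inverses are treated as independent symbols, so \<open>algebra\<close> meets
    no division.\<close>
  show ?AA
    using 1 unfolding g w k n divide_inverse inverse_mult_distrib by algebra
  show ?AD
    using 2 unfolding g w k n divide_inverse inverse_mult_distrib by algebra
  show ?DD
    using 4 unfolding g w k n divide_inverse inverse_mult_distrib by algebra
  show ?DA
    using 3 unfolding g w k n divide_inverse inverse_mult_distrib by algebra
qed

end

section \<open>Eigenvalues on the reference states\<close>

text \<open>The difference of the two products does not involve \<open>m\<close>. This lets the
  eigenvalue formulas keep their form when a site is added.\<close>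

lemma wa_mult_wa: "wa \<gamma> (u - m) * wa \<gamma> (u + m) = wb (u - m) * wb (u + m) + sinh \<gamma> * wa \<gamma> (2 * u)"
  using sinh_three_term[of "u - m" \<gamma> "2 * m"] sinh_three_term[of \<gamma> "u - m" "u + m"]
  by (simp add: wa_def wb_def algebra_simps)

text \<open>The inner layers never change the spin at a later site \<open>m\<close>, so the slice
  \<open>s m = t\<close> is preserved.\<close>

lemma dressed_local:
  assumes "n < m" "\<And>a s. s m = t \<Longrightarrow> \<Psi> a s = 0" "s m = t"
  shows "dressed \<gamma> h \<mu> n u \<Psi> a s = 0"
  using assms
proof (induction n arbitrary: \<Psi> a s)
  case 0
  then show ?case by (simp add: Kaux_def)
next
  case (Suc n)
  have R: "Rsite \<gamma> w (Suc n) \<Psi> a s = 0" if "\<And>a s. s m = t \<Longrightarrow> \<Psi> a s = 0" "s m = t" for w \<Psi> a s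
    using that Suc.prems(1) by (simp add: Rsite_def)
  show ?case
    using Suc.prems by (auto intro!: R Suc.IH)
qed

text \<open>Aligned spins meet only the diagonal weight of \<open>R\<close>, so each layer
  multiplies by a scalar. Only the spins at \<open>1..n\<close> are constrained, which lets
  \<open>dressed_vacuum_down\<close> apply this to a vector excited at site
  \<open>Suc n\<close>.\<close>

lemma dressed_vacuum_up:
  assumes "\<And>s k. k \<in> {1..n} \<Longrightarrow> s k \<Longrightarrow> \<psi> s = 0"
  shows "dressed \<gamma> h \<mu> n u (\<lambda>a s. if a then 0 else c * \<psi> s) = (\<lambda>a s. if a then 0 else LamA n \<gamma> h \<mu> u * c * \<psi> s)"
  using assms
proof (induction n arbitrary: c)
  case 0
  show ?case by (auto simp: fun_eq_iff Kaux_def LamA_def wb_def)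
next
  case (Suc n)
  have R: "Rsite \<gamma> w (Suc n) (\<lambda>a s. if a then 0 else c * \<psi> s) =
      (\<lambda>a s. if a then 0 else sinh (w + \<gamma>) * c * \<psi> s)" for w c
    using Suc.prems[of "Suc n"] by (auto simp: fun_eq_iff Rsite_def)
  have IH: "dressed \<gamma> h \<mu> n u (\<lambda>a s. if a then 0 else c * \<psi> s) =
      (\<lambda>a s. if a then 0 else LamA n \<gamma> h \<mu> u * c * \<psi> s)" for c
    by (rule Suc.IH) (rule Suc.prems, auto)
  show ?case
    by (simp only: dressed.simps R IH) (simp add: LamA_def wa_def fun_eq_iff algebra_simps)
qed

text \<open>A layer either keeps the auxiliary spin down or exchanges it with the new site; in the
  latter case the inner layers act through \<open>LamA\<close> and the outer \<open>R\<close>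
  exchanges it back. The contributions combine by \<open>wa_mult_wa\<close>.\<close>

lemma dressed_vacuum_down:
  assumes "\<And>s k. k \<in> {1..n} \<Longrightarrow> s k \<Longrightarrow> \<psi> s = 0" "sinh (2 * u + \<gamma>) \<noteq> 0"
  shows "dressed \<gamma> h \<mu> n u (\<lambda>a s. if a then \<psi> s else 0) True s =
    (LamDt n \<gamma> h \<mu> u + sinh \<gamma> / sinh (2 * u + \<gamma>) * LamA n \<gamma> h \<mu> u) * \<psi> s"
  using assms(1)
proof (induction n arbitrary: s)
  case 0
  have "sinh (2 * u + \<gamma>) * sinh (h - u) = sinh \<gamma> * sinh (h + u) - sinh (2 * u) * sinh (u - h + \<gamma>)"
    using sinh_three_term[of \<gamma> "2 * u" "h - u - \<gamma>"] sinh_minus[of "u - h + \<gamma>"] by (simp add: algebra_simps)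
  then have "sinh (h - u) = LamDt 0 \<gamma> h \<mu> u + sinh \<gamma> / sinh (2 * u + \<gamma>) * LamA 0 \<gamma> h \<mu> u"
    using assms(2) by (simp add: LamA_def LamDt_def wa_def wb_def field_simps)
  then show ?case
    by (simp add: Kaux_def)
next
  case (Suc n)
  let ?m = "Suc n"
  let ?w = "u - \<mu> ?m" and ?w' = "u + \<mu> ?m"
  \<comment> \<open>The vector left after the auxiliary excitation has moved to the new
    site.\<close>
  define \<phi> where "\<phi> s = (if s ?m then \<psi> (s(?m := False)) else 0)" for s
  let ?X = "dressed \<gamma> h \<mu> n u (\<lambda>a s. if a then \<psi> s else 0)"
  have zero: "\<psi> s = 0" if "s ?m" for s
    using Suc.prems[of ?m] that by simp
  have R: "Rsite \<gamma> ?w' ?m (\<lambda>a s. if a then \<psi> s else 0) =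
      (\<lambda>a s. sinh ?w' * (if a then \<psi> s else 0) + (if a then 0 else sinh \<gamma> * \<phi> s))"
    using zero by (auto simp: fun_eq_iff Rsite_def \<phi>_def)
  have "dressed \<gamma> h \<mu> n u (\<lambda>a s. if a then 0 else sinh \<gamma> * \<phi> s) =
      (\<lambda>a s. if a then 0 else LamA n \<gamma> h \<mu> u * sinh \<gamma> * \<phi> s)"
  proof (rule dressed_vacuum_up)
    show "\<phi> s = 0" if "k \<in> {1..n}" "s k" for s k
    proof -
      have "\<psi> (s(?m := False)) = 0"
        by (rule Suc.prems[of k]) (use that in auto)
      then show ?thesis by (simp add: \<phi>_def)
    qed
  qed
  then have X: "dressed \<gamma> h \<mu> n u (Rsite \<gamma> ?w' ?m (\<lambda>a s. if a then \<psi> s else 0)) =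
      (\<lambda>a s. sinh ?w' * ?X a s + (if a then 0 else LamA n \<gamma> h \<mu> u * sinh \<gamma> * \<phi> s))"
    unfolding R dressed_lincomb by simp
  \<comment> \<open>Without such an exchange the new site stays unexcited.\<close>
  have X0: "?X False (s(?m := True)) = 0"
    by (rule dressed_local[of _ ?m True]) (auto simp: zero)
  have IH: "?X True s = (LamDt n \<gamma> h \<mu> u + sinh \<gamma> / sinh (2 * u + \<gamma>) * LamA n \<gamma> h \<mu> u) * \<psi> s"
    by (rule Suc.IH) (rule Suc.prems, auto)
  show ?case
  proof (cases "s ?m")
    case True
    then show ?thesis
      using zero[of s] IH by (simp add: X Rsite_def)
  next
    case False
    then have "\<phi> (s(?m := True)) = \<psi> s"
      by (simp add: \<phi>_def fun_upd_idem)
    with False have "dressed \<gamma> h \<mu> ?m u (\<lambda>a s. if a then \<psi> s else 0) True s =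
       (sinh ?w * sinh ?w' * (LamDt n \<gamma> h \<mu> u + sinh \<gamma> / sinh (2 * u + \<gamma>) * LamA n \<gamma> h \<mu> u)
        + (sinh \<gamma>)\<^sup>2 * LamA n \<gamma> h \<mu> u) * \<psi> s"
      by (simp add: X X0 Rsite_def IH power2_eq_square algebra_simps)
    also have "sinh ?w * sinh ?w' * (LamDt n \<gamma> h \<mu> u + sinh \<gamma> / sinh (2 * u + \<gamma>) * LamA n \<gamma> h \<mu> u)
        + (sinh \<gamma>)\<^sup>2 * LamA n \<gamma> h \<mu> u = LamDt ?m \<gamma> h \<mu> u + sinh \<gamma> / sinh (2 * u + \<gamma>) * LamA ?m \<gamma> h \<mu> u"
    proof -
      have "LamDt ?m \<gamma> h \<mu> u = LamDt n \<gamma> h \<mu> u * (sinh ?w * sinh ?w')"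
        "LamA ?m \<gamma> h \<mu> u = LamA n \<gamma> h \<mu> u * (sinh ?w * sinh ?w' + sinh \<gamma> * sinh (2 * u + \<gamma>))"
        using wa_mult_wa[of \<gamma> u "\<mu> ?m"] by (simp_all add: LamDt_def LamA_def wb_def wa_def)
      then show ?thesis
        using assms(2) by (simp add: field_simps power2_eq_square)
    qed
    finally show ?thesis .
  qed
qed

text \<open>Evaluation at a configuration uses one row of \<open>R\<close>; with auxiliary and site
  spins both down that row is diagonal, so \<open>\<Psi>\<close> may be arbitrary.\<close>

lemma dressed_all_down_True:
  assumes "\<And>k. k \<in> {1..n} \<Longrightarrow> s k"
  shows "dressed \<gamma> h \<mu> n u \<Psi> True s = sinh (h - u) * (\<Prod>j=1..n. wa \<gamma> (u - \<mu> j) * wa \<gamma> (u + \<mu> j)) * \<Psi> True s"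
  using assms
  by (induction n arbitrary: \<Psi>) (simp_all add: Kaux_def Rsite_def wa_def)

text \<open>Counterpart of \<open>dressed_vacuum_down\<close> for the left eigenvector: the row of
  \<open>R\<close> at the new site either keeps the auxiliary spin up or exchanges it, and the
  exchange contributes through \<open>dressed_all_down_True\<close>.\<close>

lemma dressed_all_down_False:
  assumes "\<And>k. k \<in> {1..n} \<Longrightarrow> s k" "sinh (2 * u + \<gamma>) \<noteq> 0"
  shows "dressed \<gamma> h \<mu> n u (\<lambda>a s. if a then 0 else \<psi> s) False s = LamAbar n \<gamma> h \<mu> u * \<psi> s"
  using assms(1)
proof (induction n)
  case 0
  have "sinh (2 * u + \<gamma>) * sinh (h + u) = sinh \<gamma> * sinh (h - u) + sinh (2 * u) * sinh (u + h + \<gamma>)"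
    using sinh_three_term[of \<gamma> "2 * u" "h - u"] sinh_three_term[of "2 * u" \<gamma> "h - u"]
    by (simp add: algebra_simps)
  then show ?case
    using assms(2) by (simp add: Kaux_def LamAbar_def wa_def wb_def wc_def field_simps)
next
  case (Suc n)
  let ?m = "Suc n"
  let ?w = "u - \<mu> ?m" and ?w' = "u + \<mu> ?m"
  let ?E = "\<lambda>a s. if a then 0 else \<psi> s"
  let ?p = "\<Prod>j=1..n. wa \<gamma> (u - \<mu> j) * wa \<gamma> (u + \<mu> j)"
  define \<Xi> where "\<Xi> = Rsite \<gamma> ?w' ?m ?E"
  \<comment> \<open>Subtracting this multiple of \<open>?E\<close> leaves a vector supported where
    the new site is up, which the inner layers cannot turn down.\<close>
  define \<Xi>' where "\<Xi>' a s = \<Xi> a s - sinh ?w' * ?E a s" for a s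
  have sm: "s ?m" using Suc.prems by simp
  have split: "\<Xi> = (\<lambda>a s. sinh ?w' * ?E a s + \<Xi>' a s)"
    by (simp add: \<Xi>'_def fun_eq_iff)
  have "\<Xi>' a s = 0" if "s ?m" for a s
    using that by (simp add: \<Xi>'_def \<Xi>_def Rsite_def)
  then have "dressed \<gamma> h \<mu> n u \<Xi>' False s = 0"
    using sm by (intro dressed_local[of _ ?m True]) auto
  then have F: "dressed \<gamma> h \<mu> n u \<Xi> False s = sinh ?w' * (LamAbar n \<gamma> h \<mu> u * \<psi> s)"
    unfolding split dressed_lincomb using Suc by simp
  have "\<Xi> True (s(?m := False)) = sinh \<gamma> * \<psi> s"
    using sm by (simp add: \<Xi>_def Rsite_def fun_upd_idem)
  then have T: "dressed \<gamma> h \<mu> n u \<Xi> True (s(?m := False)) = sinh (h - u) * ?p * (sinh \<gamma> * \<psi> s)"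
    using Suc.prems by (subst dressed_all_down_True) auto
  have "dressed \<gamma> h \<mu> ?m u ?E False s =
     (sinh ?w * sinh ?w' * LamAbar n \<gamma> h \<mu> u + (sinh \<gamma>)\<^sup>2 * sinh (h - u) * ?p) * \<psi> s"
    using sm F T by (simp add: \<Xi>_def Rsite_def[of _ "?w"] power2_eq_square algebra_simps)
  also have "sinh ?w * sinh ?w' * LamAbar n \<gamma> h \<mu> u + (sinh \<gamma>)\<^sup>2 * sinh (h - u) * ?p = LamAbar ?m \<gamma> h \<mu> u"
  proof -
    have "(\<Prod>j=1..?m. wa \<gamma> (u - \<mu> j) * wa \<gamma> (u + \<mu> j)) = ?p * (sinh ?w * sinh ?w' + sinh \<gamma> * sinh (2 * u + \<gamma>))"
      using wa_mult_wa[of \<gamma> u "\<mu> ?m"] by (simp add: wa_def wb_def)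
    then show ?thesis
      unfolding LamAbar_def using assms(2)
      by (simp add: field_simps power2_eq_square wa_def wb_def wc_def)
  qed
  finally show ?case .
qed

context
  fixes \<gamma> h :: complex and \<mu> :: "nat \<Rightarrow> complex" and L :: nat
begin

text \<open>Encodes \<open>|0>\<close>. Configurations are defined on all of \<open>nat\<close>, and
  spins outside \<open>1..L\<close> are left free.\<close>

definition vacuum :: "(nat \<Rightarrow> bool) \<Rightarrow> complex" where
  "vacuum s = (if \<exists>k\<in>{1..L}. s k then 0 else 1)"

lemma opA_vacuum: "opA \<gamma> h \<mu> L u vacuum = (\<lambda>s. LamA L \<gamma> h \<mu> u * vacuum s)"
proof -
  have 1: "(\<lambda>k. if k = False then vacuum else (\<lambda>_. 0)) = (\<lambda>a s. if a then 0 else 1 * vacuum s)"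
    by (simp add: fun_eq_iff)
  have 2: "dressed \<gamma> h \<mu> L u (\<lambda>a s. if a then 0 else 1 * vacuum s) =
      (\<lambda>a s. if a then 0 else LamA L \<gamma> h \<mu> u * 1 * vacuum s)"
    by (rule dressed_vacuum_up) (auto simp: vacuum_def)
  show ?thesis
    unfolding entry_def 1 2 by simp
qed

lemma opDt_vacuum:
  assumes "sinh (2 * u + \<gamma>) \<noteq> 0"
  shows "opDt \<gamma> h \<mu> L u vacuum = (\<lambda>s. LamDt L \<gamma> h \<mu> u * vacuum s)"
proof
  fix s
  have 1: "(\<lambda>k. if k = True then vacuum else (\<lambda>_. 0)) = (\<lambda>a s. if a then vacuum s else 0)"
    by (simp add: fun_eq_iff)
  have 2: "dressed \<gamma> h \<mu> L u (\<lambda>a s. if a then vacuum s else 0) True s =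
     (LamDt L \<gamma> h \<mu> u + sinh \<gamma> / sinh (2 * u + \<gamma>) * LamA L \<gamma> h \<mu> u) * vacuum s"
    by (rule dressed_vacuum_down) (auto simp: vacuum_def assms)
  have "opD \<gamma> h \<mu> L u vacuum s =
     (LamDt L \<gamma> h \<mu> u + sinh \<gamma> / sinh (2 * u + \<gamma>) * LamA L \<gamma> h \<mu> u) * vacuum s"
    unfolding entry_def 1 2 ..
  then show "opDt \<gamma> h \<mu> L u vacuum s = LamDt L \<gamma> h \<mu> u * vacuum s"
    by (simp add: opDt_def opA_vacuum algebra_simps)
qed

text \<open>Evaluation at the all-down configuration is pairing with \<open><0bar|\<close>, so this
  is the left eigenvalue equation.\<close>

lemma opA_all_down:
  assumes "sinh (2 * u + \<gamma>) \<noteq> 0"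
  shows "opA \<gamma> h \<mu> L u \<psi> (\<lambda>_. True) = LamAbar L \<gamma> h \<mu> u * \<psi> (\<lambda>_. True)"
proof -
  have "(\<lambda>k. if k = False then \<psi> else (\<lambda>_. 0)) = (\<lambda>a s. if a then 0 else \<psi> s)"
    by (simp add: fun_eq_iff)
  then show ?thesis
    unfolding entry_def using dressed_all_down_False[OF _ assms] by simp
qed

end

section \<open>The off-shell Bethe ansatz\<close>

context
  fixes \<gamma> h :: complex and \<mu> :: "nat \<Rightarrow> complex" and L :: nat and lam :: "nat \<Rightarrow> complex"
begin

text \<open>By \<open>exchange_BB\<close> a product of \<open>opB\<close> over a finite set does not
  depend on the order; indexing by sets keeps orderings out of the expansion.\<close>

definition bethe_vec :: "nat set \<Rightarrow> (nat \<Rightarrow> bool) \<Rightarrow> complex" where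
  "bethe_vec I = Finite_Set.fold (\<lambda>i. opB \<gamma> h \<mu> L (lam i)) (vacuum L) I"

lemma bethe_vec_empty: "bethe_vec {} = vacuum L"
  by (simp add: bethe_vec_def)

lemma bethe_vec_insert:
  assumes "finite I" "i \<notin> I"
  shows "bethe_vec (insert i I) = opB \<gamma> h \<mu> L (lam i) (bethe_vec I)"
proof -
  interpret comp_fun_commute "\<lambda>i. opB \<gamma> h \<mu> L (lam i)"
    by standard (simp add: fun_eq_iff exchange_BB)
  show ?thesis
    using assms by (simp add: bethe_vec_def)
qed

lemma foldr_opB_eq_bethe_vec:
  "distinct is \<Longrightarrow> foldr (\<lambda>i. opB \<gamma> h \<mu> L (lam i)) is (vacuum L) = bethe_vec (set is)"
  by (induction "is") (simp_all add: bethe_vec_empty bethe_vec_insert)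

text \<open>Makes every denominator nonzero in the exchange of operators with distinct indices from
  \<open>I\<close>.\<close>

definition admissible :: "nat set \<Rightarrow> bool" where
  "admissible I \<longleftrightarrow> (\<forall>i\<in>I. sinh (2 * lam i + \<gamma>) \<noteq> 0) \<and>
     (\<forall>i\<in>I. \<forall>j\<in>I. i \<noteq> j \<longrightarrow> sinh (lam j - lam i) \<noteq> 0 \<and> sinh (lam j + lam i + \<gamma>) \<noteq> 0)"

text \<open>The linear bookkeeping of one exchange, shared by \<open>opA\<close> and
  \<open>opDt\<close>: in \<open>\<phi>\<close> the moving operator has kept its parameter
  \<open>x\<close>, in \<open>\<alpha>\<close> and \<open>\<delta>\<close> it has taken over
  \<open>y\<close>. The term at \<open>y\<close> is new, and each older \<open>z\<close> collects
  three contributions.\<close>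

lemma bethe_step:
  assumes S: "finite S" "x \<notin> S" "y \<notin> S" "x \<noteq> y"
    and X: "\<phi> = (\<lambda>s. p * bethe_vec S s + (\<Sum>z\<in>S. cx z * bethe_vec (insert x (S - {z})) s))"
    and A: "\<alpha> = (\<lambda>s. q * bethe_vec S s + (\<Sum>z\<in>S. ca z * bethe_vec (insert y (S - {z})) s))"
    and D: "\<delta> = (\<lambda>s. r * bethe_vec S s + (\<Sum>z\<in>S. cd z * bethe_vec (insert y (S - {z})) s))"
    and p': "p' = F * p"
    and cy: "c' y = G * q + W * r"
    and cz: "\<And>z. z \<in> S \<Longrightarrow> c' z = F * cx z + G * ca z + W * cd z"
  shows "F * opB \<gamma> h \<mu> L (lam y) \<phi> s + G * opB \<gamma> h \<mu> L (lam x) \<alpha> s + W * opB \<gamma> h \<mu> L (lam x) \<delta> s =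
    p' * bethe_vec (insert y S) s + (\<Sum>z\<in>insert y S. c' z * bethe_vec (insert x (insert y S - {z})) s)"
proof -
  let ?N = "\<lambda>z. bethe_vec (insert x (insert y S - {z}))"
  have Bx: "opB \<gamma> h \<mu> L (lam x) (bethe_vec S) = ?N y"
    using S by (simp add: bethe_vec_insert)
  have By: "opB \<gamma> h \<mu> L (lam y) (bethe_vec S) = bethe_vec (insert y S)"
    using S by (simp add: bethe_vec_insert)
  have Bxz: "opB \<gamma> h \<mu> L (lam x) (bethe_vec (insert y (S - {z}))) = ?N z" if "z \<in> S" for z
  proof -
    have "insert y S - {z} = insert y (S - {z})" using S that by auto
    then show ?thesis using S that by (simp add: bethe_vec_insert)
  qed
  have Byz: "opB \<gamma> h \<mu> L (lam y) (bethe_vec (insert x (S - {z}))) = ?N z" if "z \<in> S" for z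
  proof -
    have "insert x (insert y S - {z}) = insert y (insert x (S - {z}))" using S that by auto
    then show ?thesis using S that by (simp add: bethe_vec_insert)
  qed
  have "opB \<gamma> h \<mu> L (lam y) \<phi> s = p * bethe_vec (insert y S) s + (\<Sum>z\<in>S. cx z * ?N z s)"
    unfolding X by (simp add: entry_lincomb entry_sum By Byz cong: sum.cong)
  moreover have "opB \<gamma> h \<mu> L (lam x) \<alpha> s = q * ?N y s + (\<Sum>z\<in>S. ca z * ?N z s)"
    unfolding A by (simp add: entry_lincomb entry_sum Bx Bxz cong: sum.cong)
  moreover have "opB \<gamma> h \<mu> L (lam x) \<delta> s = r * ?N y s + (\<Sum>z\<in>S. cd z * ?N z s)"
    unfolding D by (simp add: entry_lincomb entry_sum Bx Bxz cong: sum.cong)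
  moreover have "(\<Sum>z\<in>insert y S. c' z * ?N z s) = c' y * ?N y s +
      (F * (\<Sum>z\<in>S. cx z * ?N z s) + G * (\<Sum>z\<in>S. ca z * ?N z s) + W * (\<Sum>z\<in>S. cd z * ?N z s))"
  proof -
    have "(\<Sum>z\<in>S. c' z * ?N z s) = (\<Sum>z\<in>S. F * (cx z * ?N z s) + G * (ca z * ?N z s) + W * (cd z * ?N z s))"
      by (intro sum.cong) (simp_all add: cz algebra_simps)
    then show ?thesis
      using S by (simp add: sum.distrib sum_distrib_left)
  qed
  ultimately show ?thesis
    by (simp add: p' cy algebra_simps)
qed

text \<open>Both expansions are proved together, by induction on \<open>S\<close>, because each
  exchange relation involves \<open>opA\<close> and \<open>opDt\<close>. For each older
  \<open>z\<close>, \<open>coef_identities\<close> collapses the three contributions to one. The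
  letter \<open>e\<close> stands for \<open>coef_h\<close>, as \<open>h\<close> is the boundary
  parameter.\<close>

lemma bethe_expansion:
  assumes "finite S" "x \<notin> S" "admissible (insert x S)"
  defines "f \<equiv> \<lambda>i j. coef_f \<gamma> (lam i) (lam j)" and "g \<equiv> \<lambda>i j. coef_g \<gamma> (lam i) (lam j)"
    and "w \<equiv> \<lambda>i j. coef_w \<gamma> (lam i) (lam j)" and "k \<equiv> \<lambda>i j. coef_k \<gamma> (lam i) (lam j)"
    and "n \<equiv> \<lambda>i j. coef_n \<gamma> (lam i) (lam j)" and "e \<equiv> \<lambda>i j. coef_h \<gamma> (lam i) (lam j)"
    and "LA \<equiv> \<lambda>i. LamA L \<gamma> h \<mu> (lam i)" and "LD \<equiv> \<lambda>i. LamDt L \<gamma> h \<mu> (lam i)"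
  shows "opA \<gamma> h \<mu> L (lam x) (bethe_vec S) = (\<lambda>s. LA x * (\<Prod>y\<in>S. f x y) * bethe_vec S s
     + (\<Sum>z\<in>S. (g x z * LA z * (\<Prod>y\<in>S - {z}. f z y) + w x z * LD z * (\<Prod>y\<in>S - {z}. e z y))
         * bethe_vec (insert x (S - {z})) s))" (is "?A x S")
    "opDt \<gamma> h \<mu> L (lam x) (bethe_vec S) = (\<lambda>s. LD x * (\<Prod>y\<in>S. e x y) * bethe_vec S s
     + (\<Sum>z\<in>S. (n x z * LA z * (\<Prod>y\<in>S - {z}. f z y) + k x z * LD z * (\<Prod>y\<in>S - {z}. e z y))
         * bethe_vec (insert x (S - {z})) s))" (is "?D x S")
proof -
  have "?A x S \<and> ?D x S"
    using assms(1-3)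
  proof (induction S arbitrary: x rule: finite_induct)
    case empty
    then show ?case
      by (simp add: bethe_vec_empty opA_vacuum opDt_vacuum admissible_def LA_def LD_def)
  next
    case (insert y S)
    have xy: "x \<notin> S" "y \<notin> S" "x \<noteq> y" using insert by auto
    have adm: "admissible (insert x S)" "admissible (insert y S)"
      using insert.prems(2) by (auto simp: admissible_def)
    \<comment> \<open>The induction hypothesis serves for the moving parameter \<open>x\<close> and
      for \<open>y\<close>, which replaces it in the unwanted terms.\<close>
    have x: "?A x S" "?D x S" using insert.IH[OF xy(1) adm(1)] by auto
    have y: "?A y S" "?D y S" using insert.IH[OF xy(2) adm(2)] by auto
    have nz: "sinh (lam i - lam j) \<noteq> 0" "sinh (lam i + lam j + \<gamma>) \<noteq> 0" "sinh (2 * lam i + \<gamma>) \<noteq> 0"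
      if "i \<in> insert x (insert y S)" "j \<in> insert x (insert y S)" "i \<noteq> j" for i j
      using insert.prems(2) that by (auto simp: admissible_def)
    have nzxy: "sinh (lam y - lam x) \<noteq> 0" "sinh (lam x - lam y) \<noteq> 0" "sinh (lam y + lam x + \<gamma>) \<noteq> 0"
      "sinh (lam x + lam y + \<gamma>) \<noteq> 0" "sinh (2 * lam x + \<gamma>) \<noteq> 0" "sinh (2 * lam y + \<gamma>) \<noteq> 0"
      using nz[of x y] nz[of y x] xy by auto
    have ids: "f x y * g x z + g x y * g y z + w x y * n y z = g x z * f z y"
      "f x y * w x z + g x y * w y z + w x y * k y z = w x z * e z y"
      "e x y * k x z + k x y * k y z + n x y * w y z = k x z * e z y"
      "e x y * n x z + k x y * n y z + n x y * g y z = n x z * f z y" if "z \<in> S" for z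
      using coef_identities[of "lam y" "lam x" "lam z" \<gamma>] nz[of y x] nz[of z x] nz[of z y] nz[of x y] that xy
      by (auto simp: f_def g_def w_def k_def n_def e_def)
    have split: "(\<Prod>j\<in>insert y S - {z}. F j) = F y * (\<Prod>j\<in>S - {z}. F j)" if "z \<in> S" for z and F :: "nat \<Rightarrow> complex"
    proof -
      have "insert y S - {z} = insert y (S - {z})" using that xy by auto
      then show ?thesis using insert.hyps by simp
    qed
    have split': "(\<Prod>j\<in>insert y S - {y}. F j) = (\<Prod>j\<in>S. F j)" for F :: "nat \<Rightarrow> complex"
      using xy by simp
    note B = bethe_vec_insert[OF insert.hyps]
    have "?A x (insert y S)"
    proof
      fix s
      have "opA \<gamma> h \<mu> L (lam x) (bethe_vec (insert y S)) s = 
        f x y * opB \<gamma> h \<mu> L (lam y) (opA \<gamma> h \<mu> L (lam x) (bethe_vec S)) s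
        + g x y * opB \<gamma> h \<mu> L (lam x) (opA \<gamma> h \<mu> L (lam y) (bethe_vec S)) s
        + w x y * opB \<gamma> h \<mu> L (lam x) (opDt \<gamma> h \<mu> L (lam y) (bethe_vec S)) s"
        unfolding B f_def g_def w_def using nzxy by (intro exchange_AB)
      also have "\<dots> = LA x * (\<Prod>j\<in>insert y S. f x j) * bethe_vec (insert y S) s
       + (\<Sum>z\<in>insert y S. (g x z * LA z * (\<Prod>j\<in>insert y S - {z}. f z j) + w x z * LD z * (\<Prod>j\<in>insert y S - {z}. e z j))
         * bethe_vec (insert x (insert y S - {z})) s)"
      proof (rule bethe_step[OF insert.hyps(1) xy x(1) y])
        show "LA x * (\<Prod>j\<in>insert y S. f x j) = f x y * (LA x * (\<Prod>j\<in>S. f x j))"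
          using insert.hyps by simp
        show "g x y * LA y * (\<Prod>j\<in>insert y S - {y}. f y j) + w x y * LD y * (\<Prod>j\<in>insert y S - {y}. e y j)
          = g x y * (LA y * (\<Prod>j\<in>S. f y j)) + w x y * (LD y * (\<Prod>j\<in>S. e y j))"
          unfolding split' by simp
        show "g x z * LA z * (\<Prod>j\<in>insert y S - {z}. f z j) + w x z * LD z * (\<Prod>j\<in>insert y S - {z}. e z j) =
          f x y * (g x z * LA z * (\<Prod>j\<in>S - {z}. f z j) + w x z * LD z * (\<Prod>j\<in>S - {z}. e z j)) +
          g x y * (g y z * LA z * (\<Prod>j\<in>S - {z}. f z j) + w y z * LD z * (\<Prod>j\<in>S - {z}. e z j)) +
          w x y * (n y z * LA z * (\<Prod>j\<in>S - {z}. f z j) + k y z * LD z * (\<Prod>j\<in>S - {z}. e z j))"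
          if "z \<in> S" for z
          unfolding split[OF that] using ids(1,2)[OF that] by algebra
      qed
      finally show "opA \<gamma> h \<mu> L (lam x) (bethe_vec (insert y S)) s = LA x * (\<Prod>j\<in>insert y S. f x j) * bethe_vec (insert y S) s
       + (\<Sum>z\<in>insert y S. (g x z * LA z * (\<Prod>j\<in>insert y S - {z}. f z j) + w x z * LD z * (\<Prod>j\<in>insert y S - {z}. e z j))
         * bethe_vec (insert x (insert y S - {z})) s)" .
    qed
    moreover have "?D x (insert y S)"
    proof
      fix s
      have "opDt \<gamma> h \<mu> L (lam x) (bethe_vec (insert y S)) s = 
        e x y * opB \<gamma> h \<mu> L (lam y) (opDt \<gamma> h \<mu> L (lam x) (bethe_vec S)) s
        + n x y * opB \<gamma> h \<mu> L (lam x) (opA \<gamma> h \<mu> L (lam y) (bethe_vec S)) s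
        + k x y * opB \<gamma> h \<mu> L (lam x) (opDt \<gamma> h \<mu> L (lam y) (bethe_vec S)) s"
        using exchange_DtB[of "lam x" "lam y" \<gamma>] nzxy by (simp add: B e_def n_def k_def)
      also have "\<dots> = LD x * (\<Prod>j\<in>insert y S. e x j) * bethe_vec (insert y S) s
       + (\<Sum>z\<in>insert y S. (n x z * LA z * (\<Prod>j\<in>insert y S - {z}. f z j) + k x z * LD z * (\<Prod>j\<in>insert y S - {z}. e z j))
         * bethe_vec (insert x (insert y S - {z})) s)"
      proof (rule bethe_step[OF insert.hyps(1) xy x(2) y])
        show "LD x * (\<Prod>j\<in>insert y S. e x j) = e x y * (LD x * (\<Prod>j\<in>S. e x j))"
          using insert.hyps by simp
        show "n x y * LA y * (\<Prod>j\<in>insert y S - {y}. f y j) + k x y * LD y * (\<Prod>j\<in>insert y S - {y}. e y j)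
          = n x y * (LA y * (\<Prod>j\<in>S. f y j)) + k x y * (LD y * (\<Prod>j\<in>S. e y j))"
          unfolding split' by simp
        show "n x z * LA z * (\<Prod>j\<in>insert y S - {z}. f z j) + k x z * LD z * (\<Prod>j\<in>insert y S - {z}. e z j) =
          e x y * (n x z * LA z * (\<Prod>j\<in>S - {z}. f z j) + k x z * LD z * (\<Prod>j\<in>S - {z}. e z j)) +
          n x y * (g y z * LA z * (\<Prod>j\<in>S - {z}. f z j) + w y z * LD z * (\<Prod>j\<in>S - {z}. e z j)) +
          k x y * (n y z * LA z * (\<Prod>j\<in>S - {z}. f z j) + k y z * LD z * (\<Prod>j\<in>S - {z}. e z j))"
          if "z \<in> S" for z
          unfolding split[OF that] using ids(3,4)[OF that] by algebra
      qed
      finally show "opDt \<gamma> h \<mu> L (lam x) (bethe_vec (insert y S)) s = LD x * (\<Prod>j\<in>insert y S. e x j) * bethe_vec (insert y S) s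
       + (\<Sum>z\<in>insert y S. (n x z * LA z * (\<Prod>j\<in>insert y S - {z}. f z j) + k x z * LD z * (\<Prod>j\<in>insert y S - {z}. e z j))
         * bethe_vec (insert x (insert y S - {z})) s)" .
    qed
    ultimately show ?case ..
  qed
  then show "?A x S" "?D x S" by auto
qed

end

section \<open>Matrix kernels as operators\<close>

lemma finite_basis: "finite (basis L)"
  using finite_lists_length_eq[of "{0, 1::nat}" L] by (simp add: basis_def conj_commute)

text \<open>List position \<open>k\<close> carries the spin of site \<open>Suc k\<close>; spins
  outside \<open>1..L\<close> are forgotten.\<close>

definition spins :: "nat \<Rightarrow> (nat \<Rightarrow> bool) \<Rightarrow> nat list" where
  "spins L s = map (\<lambda>k. of_bool (s k)) [1..<Suc L]"

lemma spins_in_basis: "spins L s \<in> basis L"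
  by (auto simp: spins_def basis_def)

lemma spins_nth: "k < L \<Longrightarrow> spins L s ! k = of_bool (s (Suc k))"
  by (simp add: spins_def del: upt_Suc)

lemma spins_upd: "k < L \<Longrightarrow> spins L (s(Suc k := b)) = (spins L s)[k := of_bool b]"
  by (rule nth_equalityI) (simp_all add: spins_def nth_list_update del: upt_Suc)

text \<open>Operators act on functions of infinite configurations, so they are compared with kernels
  only on functions that factor through \<open>spins L\<close>.\<close>

definition represents :: "nat \<Rightarrow> kern \<Rightarrow> ((bool \<Rightarrow> (nat \<Rightarrow> bool) \<Rightarrow> complex) \<Rightarrow> bool \<Rightarrow> (nat \<Rightarrow> bool) \<Rightarrow> complex) \<Rightarrow> bool" where
  "represents L P F \<longleftrightarrow> (\<forall>f. F (\<lambda>a s. f (of_bool a, spins L s)) =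
     (\<lambda>a s. \<Sum>y\<in>{0, 1} \<times> basis L. P (of_bool a, spins L s) y * f y))"

lemma represents_kid: "represents L kid (\<lambda>\<Psi>. \<Psi>)"
proof -
  have "(\<Sum>y\<in>{0, 1} \<times> basis L. kid (of_bool a, spins L s) y * f y) = f (of_bool a, spins L s)" for a s f
  proof -
    have "(\<Sum>y\<in>{0, 1} \<times> basis L. kid (of_bool a, spins L s) y * f y) =
        (\<Sum>y\<in>{0, 1} \<times> basis L. if (of_bool a, spins L s) = y then f y else 0)"
      by (intro sum.cong) (auto simp: kid_def)
    also have "\<dots> = f (of_bool a, spins L s)"
      using spins_in_basis by (simp add: finite_basis)
    finally show ?thesis .
  qed
  then show ?thesis by (simp add: represents_def)
qed

lemma represents_kmul:
  assumes "represents L P F" "represents L Q G"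
  shows "represents L (kmul L P Q) (\<lambda>\<Psi>. F (G \<Psi>))"
  unfolding represents_def
proof (intro allI ext)
  fix f a s
  let ?X = "{0, 1::nat} \<times> basis L"
  define g where "g x = (\<Sum>y\<in>?X. Q x y * f y)" for x
  have "F (G (\<lambda>a s. f (of_bool a, spins L s))) a s = F (\<lambda>a s. g (of_bool a, spins L s)) a s"
    using assms(2) by (simp add: represents_def g_def)
  also have "\<dots> = (\<Sum>z\<in>?X. P (of_bool a, spins L s) z * g z)"
    using assms(1) by (simp add: represents_def)
  also have "\<dots> = (\<Sum>z\<in>?X. \<Sum>y\<in>?X. P (of_bool a, spins L s) z * Q z y * f y)"
    by (simp add: g_def sum_distrib_left mult.assoc)
  also have "\<dots> = (\<Sum>y\<in>?X. kmul L P Q (of_bool a, spins L s) y * f y)"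
    by (subst sum.swap) (simp add: kmul_def sum_distrib_right)
  finally show "F (G (\<lambda>a s. f (of_bool a, spins L s))) a s = \<dots>" .
qed

lemma represents_Kop: "represents L (Kop h u) (Kaux h u)"
  unfolding represents_def
proof (intro allI ext)
  fix f a s
  have "(\<Sum>y\<in>{0, 1} \<times> basis L. Kop h u (of_bool a, spins L s) y * f y) =
      (\<Sum>y\<in>{0, 1} \<times> basis L. if (of_bool a, spins L s) = y then (if a then sinh (h - u) else sinh (h + u)) * f y else 0)"
    by (intro sum.cong) (auto simp: Kop_def)
  also have "\<dots> = Kaux h u (\<lambda>a s. f (of_bool a, spins L s)) a s"
    using spins_in_basis by (simp add: finite_basis Kaux_def)
  finally show "Kaux h u (\<lambda>a s. f (of_bool a, spins L s)) a s =
     (\<Sum>y\<in>{0, 1} \<times> basis L. Kop h u (of_bool a, spins L s) y * f y)" ..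
qed

text \<open>A row has nonzero entries at most at the diagonal and the swapped index. For equal spins
  these indices coincide, and the second summand is zero so that the entry is not counted
  twice.\<close>

lemma Rop_decompose:
  assumes "m < L" "xs \<in> basis L" "y \<in> {0, 1} \<times> basis L"
  shows "Rop L \<gamma> (Suc m) u (i, xs) y =
    (if (i, xs) = y then (if i = xs ! m then wa \<gamma> u else wb u) else 0)
    + (if (xs ! m, xs[m := i]) = y then (if i = xs ! m then 0 else wc \<gamma> u) else 0)"
proof -
  obtain j ys where y: "y = (j, ys)" by (cases y)
  have len: "length xs = L" "length ys = L"
    using assms y by (auto simp: basis_def)
  have *: "(\<forall>k<L. k \<noteq> m \<longrightarrow> xs ! k = ys ! k) \<longleftrightarrow> ys = xs[m := ys ! m]"
    using len assms(1) by (auto simp: list_eq_iff_nth_eq nth_list_update)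
  have eq: "ys = xs[m := a] \<longleftrightarrow> ys = xs[m := ys ! m] \<and> ys ! m = a" for a
    using len assms(1) by (metis nth_list_update_eq)
  have eq1: "xs = ys \<longleftrightarrow> ys = xs[m := ys ! m] \<and> ys ! m = xs ! m"
    using eq[of "xs ! m"] by auto
  have eq2: "xs[m := i] = ys \<longleftrightarrow> ys = xs[m := ys ! m] \<and> ys ! m = i"
    using eq[of i] by auto
  show ?thesis
    unfolding y Rop_def Rmat_def prod.inject eq1 eq2 by (auto simp: *)
qed

lemma represents_Rop:
  assumes "m < L"
  shows "represents L (Rop L \<gamma> (Suc m) u) (Rsite \<gamma> u (Suc m))"
  unfolding represents_def
proof (intro allI ext)
  fix f a s
  let ?X = "{0, 1::nat} \<times> basis L"
  let ?xs = "spins L s" and ?i = "of_bool a :: nat"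
  let ?y = "(?xs ! m, ?xs[m := ?i])"
  have y: "?y = (of_bool (s (Suc m)), spins L (s(Suc m := a)))"
    using assms by (simp add: spins_nth spins_upd)
  have "(\<Sum>y\<in>?X. Rop L \<gamma> (Suc m) u (?i, ?xs) y * f y) =
      (\<Sum>y\<in>?X. (if (?i, ?xs) = y then (if ?i = ?xs ! m then wa \<gamma> u else wb u) * f y else 0)
        + (if ?y = y then (if ?i = ?xs ! m then 0 else wc \<gamma> u) * f y else 0))"
    by (intro sum.cong refl, subst Rop_decompose[OF assms spins_in_basis])
       (auto simp: algebra_simps)
  also have "\<dots> = (if ?i = ?xs ! m then wa \<gamma> u else wb u) * f (?i, ?xs)
      + (if ?i = ?xs ! m then 0 else wc \<gamma> u) * f ?y"
    unfolding sum.distrib y using spins_in_basis by (simp add: finite_basis)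
  also have "\<dots> = Rsite \<gamma> u (Suc m) (\<lambda>a s. f (of_bool a, spins L s)) a s"
    unfolding y using assms by (simp add: Rsite_def spins_nth wa_def wb_def wc_def)
  finally show "Rsite \<gamma> u (Suc m) (\<lambda>a s. f (of_bool a, spins L s)) a s =
     (\<Sum>y\<in>?X. Rop L \<gamma> (Suc m) u (?i, ?xs) y * f y)" ..
qed

text \<open>Unrolling the dressing recursion collects the left \<open>R\<close> factors into
  \<open>tau_n\<close> and the right ones into \<open>taubar_n\<close>, with the boundary matrix in
  the middle.\<close>

lemma represents_dressed_factors:
  assumes "n \<le> L"
  shows "\<exists>F G. represents L (tau_n L \<gamma> \<mu> n u) F \<and> represents L (taubar_n L \<gamma> \<mu> n u) G
     \<and> dressed \<gamma> h \<mu> n u = (\<lambda>\<Psi>. F (Kaux h u (G \<Psi>)))"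
  using assms
proof (induction n)
  case 0
  have "dressed \<gamma> h \<mu> 0 u = (\<lambda>\<Psi>. Kaux h u \<Psi>)"
    by (rule ext) simp
  then show ?case using represents_kid[of L] by fastforce
next
  case (Suc n)
  then obtain F G where FG: "represents L (tau_n L \<gamma> \<mu> n u) F" "represents L (taubar_n L \<gamma> \<mu> n u) G"
    "dressed \<gamma> h \<mu> n u = (\<lambda>\<Psi>. F (Kaux h u (G \<Psi>)))" by auto
  have R: "represents L (Rop L \<gamma> (Suc n) w) (Rsite \<gamma> w (Suc n))" for w
    using Suc.prems by (simp add: represents_Rop)
  have "represents L (tau_n L \<gamma> \<mu> (Suc n) u) (\<lambda>\<Psi>. Rsite \<gamma> (u - \<mu> (Suc n)) (Suc n) (F \<Psi>))"
    "represents L (taubar_n L \<gamma> \<mu> (Suc n) u) (\<lambda>\<Psi>. G (Rsite \<gamma> (u + \<mu> (Suc n)) (Suc n) \<Psi>))"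
    using represents_kmul[OF R FG(1)] represents_kmul[OF FG(2) R] by simp_all
  moreover have "dressed \<gamma> h \<mu> (Suc n) u =
     (\<lambda>\<Psi>. Rsite \<gamma> (u - \<mu> (Suc n)) (Suc n) (F (Kaux h u (G (Rsite \<gamma> (u + \<mu> (Suc n)) (Suc n) \<Psi>)))))"
    using FG(3) by (intro ext) simp
  ultimately show ?case by blast
qed

lemma represents_Tmon: "represents L (Tmon L \<gamma> h \<mu> u) (dressed \<gamma> h \<mu> L u)"
proof -
  obtain F G where FG: "represents L (tau_n L \<gamma> \<mu> L u) F" "represents L (taubar_n L \<gamma> \<mu> L u) G"
    "dressed \<gamma> h \<mu> L u = (\<lambda>\<Psi>. F (Kaux h u (G \<Psi>)))"
    using represents_dressed_factors[of L L \<gamma> \<mu> u h] by auto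
  show ?thesis
    unfolding FG(3) Tmon_def tau_def taubar_def
    using represents_kmul[OF represents_kmul[OF FG(1) represents_Kop] FG(2)] .
qed

lemma opB_represents:
  "opB \<gamma> h \<mu> L u (\<lambda>s. f (spins L s)) = (\<lambda>s. \<Sum>ys\<in>basis L. Bop L \<gamma> h \<mu> u (spins L s) ys * f ys)"
proof
  fix s
  \<comment> \<open>Support on auxiliary index 1 selects the column that defines
    \<open>Bop\<close>.\<close>
  let ?g = "\<lambda>y :: nat \<times> nat list. if fst y = 1 then f (snd y) else 0 :: complex"
  have "(\<lambda>k. if k = True then (\<lambda>s. f (spins L s)) else (\<lambda>_. 0)) = (\<lambda>a s. ?g (of_bool a, spins L s))"
    by (auto simp: fun_eq_iff)
  then have "opB \<gamma> h \<mu> L u (\<lambda>s. f (spins L s)) s = dressed \<gamma> h \<mu> L u (\<lambda>a s. ?g (of_bool a, spins L s)) False s"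
    unfolding entry_def by (rule arg_cong)
  also have "\<dots> = (\<Sum>y\<in>{0, 1} \<times> basis L. Tmon L \<gamma> h \<mu> u (of_bool False, spins L s) y * ?g y)"
    using represents_Tmon[of L \<gamma> h \<mu> u, unfolded represents_def, THEN spec[where x = ?g]]
    by (simp only:)
  also have "\<dots> = (\<Sum>j\<in>{0, 1}. \<Sum>ys\<in>basis L. Tmon L \<gamma> h \<mu> u (0, spins L s) (j, ys) * (if j = 1 then f ys else 0))"
    unfolding sum.cartesian_product by (intro sum.cong) auto
  also have "\<dots> = (\<Sum>ys\<in>basis L. Bop L \<gamma> h \<mu> u (spins L s) ys * f ys)"
    by (simp add: Bop_def)
  finally show "opB \<gamma> h \<mu> L u (\<lambda>s. f (spins L s)) s = \<dots>" .
qed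

lemma Bprod_represents:
  "foldr (opB \<gamma> h \<mu> L) us (\<lambda>s. f (spins L s)) = (\<lambda>s. \<Sum>ys\<in>basis L. Bprod L \<gamma> h \<mu> us (spins L s) ys * f ys)"
proof (induction us)
  case Nil
  have "(\<Sum>ys\<in>basis L. qid (spins L s) ys * f ys) = (\<Sum>ys\<in>basis L. if spins L s = ys then f ys else 0)" for s
    by (intro sum.cong) (auto simp: qid_def)
  then show ?case
    using spins_in_basis by (simp add: finite_basis fun_eq_iff)
next
  case (Cons u us)
  define g where "g xs = (\<Sum>ys\<in>basis L. Bprod L \<gamma> h \<mu> us xs ys * f ys)" for xs
  have "foldr (opB \<gamma> h \<mu> L) (u # us) (\<lambda>s. f (spins L s)) = opB \<gamma> h \<mu> L u (\<lambda>s. g (spins L s))"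
    by (simp add: Cons.IH g_def)
  also have "\<dots> = (\<lambda>s. \<Sum>ys\<in>basis L. Bprod L \<gamma> h \<mu> (u # us) (spins L s) ys * f ys)"
    unfolding opB_represents
    by (simp add: g_def qmul_def sum_distrib_left sum_distrib_right mult.assoc) (subst sum.swap, rule refl)
  finally show ?case .
qed

text \<open>The vacuum is the indicator of the list of zeros and selects the column of
  \<open>Bprod\<close>; evaluation at the all-down configuration selects the row.\<close>

lemma Zpf_eq: "Zpf L \<gamma> h \<mu> us = foldr (opB \<gamma> h \<mu> L) us (vacuum L) (\<lambda>_. True)"
proof -
  let ?f = "\<lambda>xs. if xs = replicate L 0 then 1 else 0 :: complex"
  have "spins L s = replicate L 0 \<longleftrightarrow> (\<forall>k\<in>{1..L}. \<not> s k)" for s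
  proof -
    have "spins L s = replicate L 0 \<longleftrightarrow> (\<forall>k<L. \<not> s (Suc k))"
      using spins_in_basis[of L s] by (auto simp: list_eq_iff_nth_eq spins_nth basis_def)
    also have "\<dots> \<longleftrightarrow> (\<forall>k\<in>{1..L}. \<not> s k)"
      unfolding image_Suc_lessThan[symmetric] by auto
    finally show ?thesis .
  qed
  then have "vacuum L = (\<lambda>s. ?f (spins L s))"
    by (auto simp: fun_eq_iff vacuum_def)
  moreover have "spins L (\<lambda>_. True) = replicate L 1"
    by (simp add: spins_def map_replicate_const)
  moreover have "replicate L 0 \<in> basis L"
    by (auto simp: basis_def)
  ultimately show ?thesis
    by (simp add: Bprod_represents[where f = ?f] Zpf_def finite_basis if_distrib[of "\<lambda>t. _ * t"] cong: if_cong)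
qed

text \<open>The conditions on \<open>wa\<close> and \<open>wb\<close> state that the denominators in
  the coefficients do not vanish.\<close>

theorem theorem1:
  fixes L :: nat and \<gamma> h :: complex and \<mu> lam :: "nat \<Rightarrow> complex"
  assumes "L > 0"
    and "\<And>i. i \<le> L \<Longrightarrow> wa \<gamma> (2 * lam i) \<noteq> 0"
    and "\<And>i j. i \<le> L \<Longrightarrow> j \<in> {1..L} \<Longrightarrow> j \<noteq> i \<Longrightarrow> wb (lam j - lam i) \<noteq> 0"
    and "\<And>i j. i \<le> L \<Longrightarrow> j \<in> {1..L} \<Longrightarrow> j \<noteq> i \<Longrightarrow> wa \<gamma> (lam j + lam i) \<noteq> 0"
    and "\<And>i j. i \<in> {1..L} \<Longrightarrow> j \<in> {1..L} \<Longrightarrow> j \<noteq> i \<Longrightarrow> wb (lam i + lam j + \<gamma>) \<noteq> 0"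
  shows
   "(LamAbar L \<gamma> h \<mu> (lam 0) - LamA L \<gamma> h \<mu> (lam 0) *
       (\<Prod>j=1..L. (wa \<gamma> (lam j - lam 0) / wb (lam j - lam 0)) * (wb (lam j + lam 0) / wa \<gamma> (lam j + lam 0))))
      * Zpf L \<gamma> h \<mu> (map lam [1..<L+1])
    + (\<Sum>i=1..L.
        ((wb (2 * lam i) / wa \<gamma> (2 * lam i)) * (wc \<gamma> (lam i - lam 0) / wb (lam i - lam 0))
           * LamA L \<gamma> h \<mu> (lam i)
           * (\<Prod>j\<in>{1..L} - {i}. (wa \<gamma> (lam j - lam i) / wb (lam j - lam i)) * (wb (lam j + lam i) / wa \<gamma> (lam j + lam i)))
         + (wc \<gamma> (lam i + lam 0) / wa \<gamma> (lam i + lam 0)) * LamDt L \<gamma> h \<mu> (lam i)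
           * (\<Prod>j\<in>{1..L} - {i}. (wa \<gamma> (lam i - lam j) / wb (lam i - lam j)) * (wa \<gamma> (lam i + lam j + \<gamma>) / wb (lam i + lam j + \<gamma>))))
        * Zpf L \<gamma> h \<mu> (lam 0 # map lam [1..<i] @ map lam [i+1..<L+1]))
    = 0"
proof -
  let ?up = "\<lambda>_::nat. True"
  let ?Z = "\<lambda>I. bethe_vec \<gamma> h \<mu> L lam I ?up"
  \<comment> \<open>For distinct indices the partition function depends only on their set, so the
    order of the parameter lists is irrelevant.\<close>
  have Z: "Zpf L \<gamma> h \<mu> (map lam is) = ?Z (set is)" if "distinct is" for "is"
    using foldr_opB_eq_bethe_vec[OF that, of \<gamma> h \<mu> L lam] by (simp add: Zpf_eq foldr_map comp_def)
  have Z0: "Zpf L \<gamma> h \<mu> (map lam [1..<L+1]) = ?Z {1..L}"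
  proof -
    have "set [1..<L+1] = {1..L}" by auto
    then show ?thesis by (simp only: Z distinct_upt)
  qed
  have Zi: "Zpf L \<gamma> h \<mu> (lam 0 # map lam [1..<i] @ map lam [i+1..<L+1]) = ?Z (insert 0 ({1..L} - {i}))"
    if "i \<in> {1..L}" for i
  proof -
    have "set (0 # [1..<i] @ [i+1..<L+1]) = insert 0 ({1..L} - {i})"
      using that by auto
    moreover have "distinct (0 # [1..<i] @ [i+1..<L+1])"
      by auto
    ultimately show ?thesis
      using Z[of "0 # [1..<i] @ [i+1..<L+1]"] by simp
  qed
  have adm: "admissible \<gamma> lam (insert 0 {1..L})"
  proof -
    have "sinh (lam j - lam i) \<noteq> 0 \<and> sinh (lam j + lam i + \<gamma>) \<noteq> 0" if "i \<le> L" "j \<le> L" "i \<noteq> j" for i j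
    \<comment> \<open>For \<open>j = 0\<close> the hypotheses are applied with \<open>i\<close> and
      \<open>j\<close> interchanged, which is harmless since \<open>sinh\<close> is odd and the sum
      symmetric.\<close>
    proof (cases "j = 0")
      case True
      then show ?thesis
        using assms(3)[of j i] assms(4)[of j i] that sinh_minus[of "lam j - lam i"]
        by (auto simp: wa_def wb_def add.commute)
    next
      case False
      then show ?thesis
        using assms(3)[of i j] assms(4)[of i j] that by (auto simp: wa_def wb_def)
    qed
    then show ?thesis
      using assms(2) by (auto simp: admissible_def wa_def)
  qed
  have coefs: "coef_f \<gamma> (lam i) (lam j) = wa \<gamma> (lam j - lam i) / wb (lam j - lam i) * (wb (lam j + lam i) / wa \<gamma> (lam j + lam i))"
    "coef_g \<gamma> (lam i) (lam j) = - (wb (2 * lam j) / wa \<gamma> (2 * lam j) * (wc \<gamma> (lam j - lam i) / wb (lam j - lam i)))"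
    "coef_w \<gamma> (lam i) (lam j) = - (wc \<gamma> (lam j + lam i) / wa \<gamma> (lam j + lam i))"
    "coef_h \<gamma> (lam i) (lam j) = wa \<gamma> (lam i - lam j) / wb (lam i - lam j) * (wa \<gamma> (lam i + lam j + \<gamma>) / wb (lam i + lam j + \<gamma>))"
    for i j
    by (simp_all add: coef_f_def coef_g_def coef_w_def coef_h_def wa_def wb_def wc_def add.assoc)
  define S where "S = (\<Sum>i=1..L. (coef_g \<gamma> (lam 0) (lam i) * LamA L \<gamma> h \<mu> (lam i) * (\<Prod>j\<in>{1..L} - {i}. coef_f \<gamma> (lam i) (lam j))
        + coef_w \<gamma> (lam 0) (lam i) * LamDt L \<gamma> h \<mu> (lam i) * (\<Prod>j\<in>{1..L} - {i}. coef_h \<gamma> (lam i) (lam j)))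
        * ?Z (insert 0 ({1..L} - {i})))"
  \<comment> \<open>First \<open>opA\<close> acts to the left, on the dual vector; the next step
    lets it act to the right.\<close>
  have "LamAbar L \<gamma> h \<mu> (lam 0) * ?Z {1..L} = opA \<gamma> h \<mu> L (lam 0) (bethe_vec \<gamma> h \<mu> L lam {1..L}) ?up"
    using assms(2)[of 0] by (subst opA_all_down) (auto simp: wa_def)
  also have "\<dots> = LamA L \<gamma> h \<mu> (lam 0) * (\<Prod>j=1..L. coef_f \<gamma> (lam 0) (lam j)) * ?Z {1..L} + S"
    unfolding S_def by (subst bethe_expansion(1)[OF _ _ adm]) auto
  finally have main: "LamAbar L \<gamma> h \<mu> (lam 0) * ?Z {1..L} =
    LamA L \<gamma> h \<mu> (lam 0) * (\<Prod>j=1..L. coef_f \<gamma> (lam 0) (lam j)) * ?Z {1..L} + S" .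
  have prod: "(\<Prod>j=1..L. (wa \<gamma> (lam j - lam 0) / wb (lam j - lam 0)) * (wb (lam j + lam 0) / wa \<gamma> (lam j + lam 0)))
    = (\<Prod>j=1..L. coef_f \<gamma> (lam 0) (lam j))"
    by (simp only: coefs)
  let ?M = "\<lambda>i. (wb (2 * lam i) / wa \<gamma> (2 * lam i)) * (wc \<gamma> (lam i - lam 0) / wb (lam i - lam 0))
           * LamA L \<gamma> h \<mu> (lam i)
           * (\<Prod>j\<in>{1..L} - {i}. (wa \<gamma> (lam j - lam i) / wb (lam j - lam i)) * (wb (lam j + lam i) / wa \<gamma> (lam j + lam i)))
         + (wc \<gamma> (lam i + lam 0) / wa \<gamma> (lam i + lam 0)) * LamDt L \<gamma> h \<mu> (lam i)
           * (\<Prod>j\<in>{1..L} - {i}. (wa \<gamma> (lam i - lam j) / wb (lam i - lam j)) * (wa \<gamma> (lam i + lam j + \<gamma>) / wb (lam i + lam j + \<gamma>)))"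
  have "(\<Sum>i=1..L. ?M i * Zpf L \<gamma> h \<mu> (lam 0 # map lam [1..<i] @ map lam [i+1..<L+1])) =
      (\<Sum>i=1..L. ?M i * ?Z (insert 0 ({1..L} - {i})))"
    by (intro sum.cong refl) (simp only: Zi)
  \<comment> \<open>\<open>coef_g\<close> and \<open>coef_w\<close> carry a minus sign relative to
    the coefficients in the statement.\<close>
  also have "\<dots> = - S"
    unfolding S_def coefs sum_negf [symmetric]
    by (simp only: mult_minus_left distrib_right minus_add_distrib minus_minus)
  finally have sum: "(\<Sum>i=1..L. ?M i * Zpf L \<gamma> h \<mu> (lam 0 # map lam [1..<i] @ map lam [i+1..<L+1])) = - S" .
  show ?thesis
    unfolding sum prod Z0 using main by (simp only: left_diff_distrib) simp
qed

end
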